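(* Let $K$ be a field, $S=K[t_1,\dots,t_s]$, $\mathfrak m=(t_1,\dots,t_s)$, and let $(0)\ne I\subsetneq\mathfrak m$ be an unmixed graded ideal of $S$ all of whose associated primes are generated by linear forms. Then $\mathrm{reg}(\delta_I)=\mathrm v(I)$.
   Context: $S=\bigoplus_{d\ge0}S_d$ has the standard grading; $K$ is arbitrary. An ideal is unmixed if it is proper and all its associated primes have the same height. With $H_I(d)=\dim_K(S_d/I_d)$ and $k=\dim(S/I)$, $\deg(S/I)=(k-1)!\lim_{d\to\infty}H_I(d)/d^{k-1}$ if $k\ge1$ and $\dim_K(S/I)$ if $k=0$. Minimum distance function: for $d\ge1$ let $\mathcal F_d$ be the set of $f\in S_d\setminus I$ with $(I:f)\ne I$. Put $\delta_I(d)=\deg(S/I)-\max\{\deg(S/(I,f)): f\in\mathcal F_d\}$ if $\mathcal F_d\neq\emptyset$, and $\delta_I(d)=\deg(S/I)$ if $\mathcal F_d=\emptyset$. Regularity index of $\delta_I$: $\mathrm{reg}(\delta_I)$ is the smallest $d\ge1$ such that $\delta_I(d)=1$; if $I$ is prime, $\mathrm{reg}(\delta_I)=1$ by convention. v-number: for a graded ideal $I\subsetneq\mathfrak m$, $\mathrm v(I)=\min\{d\ge1 : \text{there exist } f\in S_d \text{ and } \mathfrak p\in\mathrm{Ass}(S/I)\text{ with }(I:f)=\mathfrak p\}$. *)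

theory Defs
  imports Complex_Main "HOL-Library.Poly_Mapping" "HOL-Library.Extended_Nat"
begin

section \<open>Ideals of a commutative ring\<close>

text \<open>Ideals are the submodules of the ring regarded as a module over itself, so the
  library theory of the locale \<^locale>\<open>module\<close> applies to them.\<close>

lemma module_mult: "module ((*) :: 'a::comm_ring_1 \<Rightarrow> 'a \<Rightarrow> 'a)"
  by unfold_locales (simp_all add: algebra_simps)

definition is_ideal :: "'a::comm_ring_1 set \<Rightarrow> bool"
  where "is_ideal = module.subspace (*)"

definition ideal_gen :: "'a::comm_ring_1 set \<Rightarrow> 'a set"
  where "ideal_gen = module.span (*)"

definition prime_ideal :: "'a::comm_ring_1 set \<Rightarrow> bool"
  where "prime_ideal P \<longleftrightarrow>
    is_ideal P \<and> P \<noteq> UNIV \<and> (\<forall>a b. a * b \<in> P \<longrightarrow> a \<in> P \<or> b \<in> P)"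

definition colon :: "'a::comm_ring_1 set \<Rightarrow> 'a \<Rightarrow> 'a set"
  where "colon I f = {g. g * f \<in> I}"

text \<open>The set \<open>Ass(R/I)\<close>; note that \<open>colon I f\<close> is the annihilator of the
  residue class of \<open>f\<close> in \<open>R/I\<close>.\<close>

definition Ass :: "'a::comm_ring_1 set \<Rightarrow> 'a set set"
  where "Ass I = {P. prime_ideal P \<and> (\<exists>f. P = colon I f)}"

text \<open>A chain \<open>c 0 \<subset> c 1 \<subset> \<dots> \<subset> c n\<close> of prime ideals, of length \<open>n\<close>.\<close>

definition prime_chain :: "nat \<Rightarrow> (nat \<Rightarrow> 'a::comm_ring_1 set) \<Rightarrow> bool"
  where "prime_chain n c \<longleftrightarrow> (\<forall>i\<le>n. prime_ideal (c i)) \<and> (\<forall>i<n. c i \<subset> c (Suc i))"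

definition height :: "'a::comm_ring_1 set \<Rightarrow> enat"
  where "height P = Sup {enat n | n c. prime_chain n c \<and> c n = P}"

text \<open>The Krull dimension of \<open>R/I\<close>, for a proper ideal \<open>I\<close>: the primes of \<open>R/I\<close> are
  identified with the primes of \<open>R\<close> containing \<open>I\<close>.\<close>

definition krull_dim_quot :: "'a::comm_ring_1 set \<Rightarrow> enat"
  where "krull_dim_quot I = Sup {enat n | n c. prime_chain n c \<and> I \<subseteq> c 0}"

definition unmixed :: "'a::comm_ring_1 set \<Rightarrow> bool"
  where "unmixed I \<longleftrightarrow>
    is_ideal I \<and> I \<noteq> UNIV \<and> (\<forall>P\<in>Ass I. \<forall>Q\<in>Ass I. height P = height Q)"


section \<open>The standard graded polynomial ring\<close>

text \<open>Exponent vectors are finitely supported functions \<open>'n \<Rightarrow>\<^sub>0 nat\<close>, and the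
  multiplication of \<^theory>\<open>HOL-Library.Poly_Mapping\<close> is convolution. For a finite type
  \<open>'n\<close> with \<open>s\<close> elements and a field \<open>'k\<close>, this type is \<open>K[t\<^sub>1,\<dots>,t\<^sub>s]\<close>.\<close>

type_synonym ('n, 'k) mpoly = "('n \<Rightarrow>\<^sub>0 nat) \<Rightarrow>\<^sub>0 'k"

definition tvar :: "'n \<Rightarrow> ('n, 'k::field) mpoly"
  where "tvar i = Poly_Mapping.single (Poly_Mapping.single i 1) 1"

definition irrelevant_ideal :: "('n, 'k::field) mpoly set"
  where "irrelevant_ideal = ideal_gen {tvar i | i. True}"

definition mon_deg :: "('n \<Rightarrow>\<^sub>0 nat) \<Rightarrow> nat"
  where "mon_deg m = (\<Sum>i\<in>Poly_Mapping.keys m. Poly_Mapping.lookup m i)"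

definition forms :: "nat \<Rightarrow> ('n, 'k::field) mpoly set"
  where "forms d = {f. \<forall>m\<in>Poly_Mapping.keys f. mon_deg m = d}"

definition hom_component :: "nat \<Rightarrow> ('n, 'k::field) mpoly \<Rightarrow> ('n, 'k) mpoly"
  where "hom_component d f =
    (\<Sum>m\<in>{m \<in> Poly_Mapping.keys f. mon_deg m = d}. Poly_Mapping.single m (Poly_Mapping.lookup f m))"

definition graded_ideal :: "('n, 'k::field) mpoly set \<Rightarrow> bool"
  where "graded_ideal I \<longleftrightarrow> is_ideal I \<and> (\<forall>f\<in>I. \<forall>d. hom_component d f \<in> I)"

definition generated_by_linear_forms :: "('n, 'k::field) mpoly set \<Rightarrow> bool"
  where "generated_by_linear_forms P \<longleftrightarrow> (\<exists>L. L \<subseteq> forms 1 \<and> P = ideal_gen L)"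


section \<open>Hilbert function and degree\<close>

definition kscale :: "'k::field \<Rightarrow> ('n, 'k) mpoly \<Rightarrow> ('n, 'k) mpoly"
  where "kscale c f = Poly_Mapping.single 0 c * f"

lemma vector_space_kscale: "vector_space (kscale :: 'k::field \<Rightarrow> ('n, 'k) mpoly \<Rightarrow> ('n, 'k) mpoly)"
  by unfold_locales
    (simp_all add: kscale_def algebra_simps single_add mult_single mult.assoc[symmetric])

text \<open>\<open>B\<close> is a set of representatives of a finite \<open>K\<close>-basis of the quotient space \<open>V/W\<close>:
  its residue classes are linearly independent (in particular pairwise distinct) and span.\<close>

definition quot_basis :: "('n, 'k::field) mpoly set \<Rightarrow> ('n, 'k) mpoly set \<Rightarrow> ('n, 'k) mpoly set \<Rightarrow> bool"
  where "quot_basis V W B \<longleftrightarrow> finite B \<and> B \<subseteq> V \<and>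
    (\<forall>c. (\<Sum>b\<in>B. kscale (c b) b) \<in> W \<longrightarrow> (\<forall>b\<in>B. c b = 0)) \<and>
    (\<forall>v\<in>V. \<exists>c. v - (\<Sum>b\<in>B. kscale (c b) b) \<in> W)"

text \<open>The dimension of \<open>V/W\<close>, where \<open>W \<subseteq> V\<close> are subspaces and \<open>V/W\<close> is finite-dimensional.\<close>

definition quot_dim :: "('n, 'k::field) mpoly set \<Rightarrow> ('n, 'k) mpoly set \<Rightarrow> nat"
  where "quot_dim V W = (THE n. \<exists>B. quot_basis V W B \<and> card B = n)"

lemma quot_basis_card_le:
  fixes W :: "('n, 'k::field) mpoly set"
  assumes W: "module.subspace kscale W" and B: "quot_basis V W B" and C: "quot_basis V W C"
  shows "card C \<le> card B"
proof -
  interpret vector_space "kscale :: 'k \<Rightarrow> ('n, 'k) mpoly \<Rightarrow> ('n, 'k) mpoly"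
    by (rule vector_space_kscale)
  have finB: "finite B" and finC: "finite C"
    using B C by (auto simp: quot_basis_def)
  have indC: "(\<Sum>b\<in>C. kscale (c b) b) \<in> W \<Longrightarrow> b \<in> C \<Longrightarrow> c b = 0" for c b
    using C by (auto simp: quot_basis_def)
  have "\<forall>x\<in>C. \<exists>p. p \<in> span B \<and> x - p \<in> W"
  proof
    fix x assume "x \<in> C"
    then obtain c where "x - (\<Sum>b\<in>B. kscale (c b) b) \<in> W"
      using B C unfolding quot_basis_def by blast
    moreover have "(\<Sum>b\<in>B. kscale (c b) b) \<in> span B"
      by (intro span_sum span_scale span_base)
    ultimately show "\<exists>p. p \<in> span B \<and> x - p \<in> W" by blast
  qed
  then obtain p where p: "\<And>x. x \<in> C \<Longrightarrow> p x \<in> span B" "\<And>x. x \<in> C \<Longrightarrow> x - p x \<in> W"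
    by metis
  have zero: "c b = 0" if "(\<Sum>x\<in>C. kscale (c x) (p x)) = 0" "b \<in> C" for c b
  proof -
    have "(\<Sum>x\<in>C. kscale (c x) x) = (\<Sum>x\<in>C. kscale (c x) (x - p x))"
      using that(1) by (simp add: scale_right_diff_distrib sum_subtractf)
    also have "\<dots> \<in> W"
      using p(2) W by (intro subspace_sum subspace_scale) auto
    finally show ?thesis using indC that(2) by blast
  qed
  have inj: "inj_on p C"
  proof (rule inj_onI, rule ccontr)
    fix x y assume xy: "x \<in> C" "y \<in> C" "p x = p y" "x \<noteq> y"
    let ?c = "\<lambda>z. if z = x then 1 else if z = y then - 1 else (0::'k)"
    have "(\<Sum>z\<in>C. kscale (?c z) (p z)) = (\<Sum>z\<in>{x, y}. kscale (?c z) (p z))"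
      using xy finC by (intro sum.mono_neutral_right) auto
    also have "\<dots> = 0" using xy by simp
    finally show False using zero[of ?c x] xy by simp
  qed
  have "independent (p ` C)"
    unfolding independent_explicit_module
  proof (intro allI impI)
    fix t u v
    assume t: "finite t" "t \<subseteq> p ` C" "(\<Sum>v\<in>t. kscale (u v) v) = 0" "v \<in> t"
    let ?c = "\<lambda>x. if p x \<in> t then u (p x) else 0"
    have "(\<Sum>x\<in>C. kscale (?c x) (p x)) = (\<Sum>y\<in>p ` C. kscale (if y \<in> t then u y else 0) y)"
      by (simp add: sum.reindex[OF inj])
    also have "\<dots> = (\<Sum>y\<in>t. kscale (u y) y)"
      using t finC by (intro sum.mono_neutral_cong_right) auto
    finally have "(\<Sum>x\<in>C. kscale (?c x) (p x)) = 0" using t by simp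
    moreover obtain x where "x \<in> C" "v = p x" using t by auto
    ultimately show "u v = 0" using zero[of ?c x] t by auto
  qed
  then have "card (p ` C) \<le> card B"
    using independent_span_bound[OF finB, of "p ` C"] p(1) by blast
  then show ?thesis using inj by (simp add: card_image)
qed

lemma quot_dim_eq:
  assumes "module.subspace kscale W" "quot_basis V W B"
  shows "quot_dim V W = card B"
  unfolding quot_dim_def
  using assms by (intro the_equality) (auto intro: antisym quot_basis_card_le)

definition hilbert_fun :: "('n, 'k::field) mpoly set \<Rightarrow> nat \<Rightarrow> nat"
  where "hilbert_fun I d = quot_dim (forms d) (I \<inter> forms d)"

text \<open>The degree \<open>deg(S/I)\<close> of the quotient.\<close>

definition degree_quot :: "('n, 'k::field) mpoly set \<Rightarrow> real"
  where "degree_quot I =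
    (let k = the_enat (krull_dim_quot I) in
      if k \<ge> 1 then fact (k - 1) * lim (\<lambda>d. real (hilbert_fun I d) / real d ^ (k - 1))
      else real (quot_dim UNIV I))"


section \<open>Minimum distance function and v-number\<close>

definition zero_divisor_forms :: "('n, 'k::field) mpoly set \<Rightarrow> nat \<Rightarrow> ('n, 'k) mpoly set"
  where "zero_divisor_forms I d = {f \<in> forms d - I. colon I f \<noteq> I}"

definition min_dist :: "('n, 'k::field) mpoly set \<Rightarrow> nat \<Rightarrow> real"
  where "min_dist I d =
    (if zero_divisor_forms I d \<noteq> {}
     then degree_quot I -
       (GREATEST r. \<exists>f\<in>zero_divisor_forms I d. r = degree_quot (ideal_gen (insert f I)))
     else degree_quot I)"

text \<open>The minima below are taken in \<^typ>\<open>enat\<close>, so that a minimum over the empty set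
  is \<open>\<infinity>\<close> rather than an unspecified number.\<close>

definition reg_min_dist :: "('n, 'k::field) mpoly set \<Rightarrow> enat"
  where "reg_min_dist I =
    (if prime_ideal I then 1 else Inf {enat d | d. 1 \<le> d \<and> min_dist I d = 1})"

definition v_number :: "('n, 'k::field) mpoly set \<Rightarrow> enat"
  where "v_number I = Inf {enat d | d. 1 \<le> d \<and> (\<exists>f\<in>forms d. \<exists>P\<in>Ass I. colon I f = P)}"

end

theory Submission
  imports Defs "HOL-Library.FuncSet"
begin

text \<open>For a form \<open>f\<close> that is a zero divisor modulo \<open>I\<close>, multiplication by \<open>f\<close> gives
  \<open>0 \<rightarrow> S/(I : f) \<rightarrow> S/I \<rightarrow> S/(I, f) \<rightarrow> 0\<close>, and since \<open>I\<close> is unmixed all three modules have the same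
  dimension \<open>t\<close>. Hence \<open>\<delta>\<^sub>I(d)\<close> is the minimum of the multiplicities of the \<open>S/(I : f)\<close>. Such a
  multiplicity is a positive integer, and it is \<open>1\<close> iff \<open>(I : f)\<close> is prime: an associated prime of
  \<open>I\<close> is linear, so it has multiplicity \<open>1\<close>; if \<open>(I : f)\<close> is properly contained in an associated
  prime \<open>P\<close>, then for a form \<open>g \<in> P - (I : f)\<close> both \<open>S/(I : g f)\<close> and \<open>S/((I : f), g)\<close> have
  positive multiplicity. Multiplicities exist and are integers because the standard monomials of
  \<open>(I : f)\<close> form a finite disjoint union of cones \<open>a + \<nat>\<^sup>T\<close>, where \<open>|T| \<le> t\<close>.\<close>

text \<open>The notions behind the degree need separate control: \<open>krull_dim_quot\<close> and
  \<open>height\<close> are suprema over arbitrary chains of primes, and \<open>lim\<close> says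
  something only if the limit exists. For dimensions, a counting argument bounds the length of every
  chain of primes by the number s of variables. A linear prime P lies on a flag of linear primes
  from (0) to the irrelevant ideal, with s - dim(S/P) steps below P and dim(S/P) steps above.
  Completing an arbitrary chain by a piece of such a flag and applying the bound s yields the height
  of P and the dimension of each ideal between I and an associated prime. This converts equal
  heights into the common dimension t. For limits, the cone argument is applied to the colon ideals
  only, where associated primes of I bound |T|; the limit for (I, f) comes out of the exact sequence
  as a difference. The ideal (I, f) keeps dimension t because a zero divisor lies in an associated
  prime.\<close>

abbreviation keys :: "('a \<Rightarrow>\<^sub>0 'b::zero) \<Rightarrow> 'a set" where "keys \<equiv> Poly_Mapping.keys"
abbreviation lookup :: "('a \<Rightarrow>\<^sub>0 'b::zero) \<Rightarrow> 'a \<Rightarrow> 'b" where "lookup \<equiv> Poly_Mapping.lookup"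
abbreviation single :: "'a \<Rightarrow> 'b \<Rightarrow> ('a \<Rightarrow>\<^sub>0 'b::zero)" where "single \<equiv> Poly_Mapping.single"

section \<open>Monomials\<close>

definition mon_dvd :: "('n \<Rightarrow>\<^sub>0 nat) \<Rightarrow> ('n \<Rightarrow>\<^sub>0 nat) \<Rightarrow> bool"
  where "mon_dvd a b \<longleftrightarrow> (\<forall>i. lookup a i \<le> lookup b i)"

lemma mon_dvd_iff: "mon_dvd a b \<longleftrightarrow> (\<exists>u. b = a + u)"
proof
  assume "mon_dvd a b"
  then have "b = a + (b - a)"
    by (intro poly_mapping_eqI) (simp add: mon_dvd_def lookup_add lookup_minus)
  then show "\<exists>u. b = a + u" by blast
qed (auto simp: mon_dvd_def lookup_add)

lemma mon_keys_add: "keys (a + b :: 'n \<Rightarrow>\<^sub>0 nat) = keys a \<union> keys b"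
  by (auto simp: in_keys_iff lookup_add)

lemma mon_deg_sum: "mon_deg (m :: 'n::finite \<Rightarrow>\<^sub>0 nat) = (\<Sum>i\<in>UNIV. lookup m i)"
  unfolding mon_deg_def by (rule sum.mono_neutral_left) (auto simp: in_keys_iff)

lemma mon_deg_add: "mon_deg (a + b :: 'n::finite \<Rightarrow>\<^sub>0 nat) = mon_deg a + mon_deg b"
  by (simp add: mon_deg_sum lookup_add sum.distrib)

lemma mon_deg_0 [simp]: "mon_deg 0 = 0"
  by (simp add: mon_deg_def)

lemma mon_deg_single [simp]: "mon_deg (single i k) = k"
  by (simp add: mon_deg_def)

lemma mon_deg_eq_0_iff: "mon_deg m = 0 \<longleftrightarrow> m = 0"
  by (auto simp: mon_deg_def intro!: poly_mapping_eqI) (metis in_keys_iff)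

lemma mon_deg_1E:
  assumes "mon_deg m = 1" obtains i where "m = single i 1"
proof -
  have "\<exists>i\<in>keys m. lookup m i = 1 \<and> (\<forall>j\<in>keys m. i \<noteq> j \<longrightarrow> lookup m j = 0)"
    using assms unfolding mon_deg_def by (subst (asm) sum_eq_1_iff) auto
  then obtain i where i: "i \<in> keys m" "lookup m i = 1"
    and "\<And>j. j \<in> keys m \<Longrightarrow> i \<noteq> j \<Longrightarrow> lookup m j = 0" by auto
  then have "m = single i 1"
    by (intro poly_mapping_eqI) (metis in_keys_iff lookup_single_eq lookup_single_not_eq)
  then show ?thesis using that by blast
qed

section \<open>Finiteness of sets of monomials and Dickson's lemma\<close>

lemma finite_mon_bounded: "finite {m :: 'n::finite \<Rightarrow>\<^sub>0 nat. \<forall>i. lookup m i \<le> b}"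
proof -
  have "lookup ` {m :: 'n \<Rightarrow>\<^sub>0 nat. \<forall>i. lookup m i \<le> b} \<subseteq> UNIV \<rightarrow>\<^sub>E {..b}"
    by (auto simp: PiE_def)
  moreover have "finite (UNIV \<rightarrow>\<^sub>E {..b} :: ('n \<Rightarrow> nat) set)"
    by (intro finite_PiE) auto
  ultimately have "finite (lookup ` {m :: 'n \<Rightarrow>\<^sub>0 nat. \<forall>i. lookup m i \<le> b})"
    by (rule finite_subset)
  then show ?thesis
    by (rule finite_imageD) (simp add: inj_on_def)
qed

lemma lookup_le_mon_deg: "lookup (m :: 'n::finite \<Rightarrow>\<^sub>0 nat) i \<le> mon_deg m"
  by (simp add: mon_deg_sum member_le_sum)

lemma finite_mon_deg: "finite {m :: 'n::finite \<Rightarrow>\<^sub>0 nat. mon_deg m = d}"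
  by (rule finite_subset[OF _ finite_mon_bounded[of d]]) (use lookup_le_mon_deg in auto)

text \<open>Dickson's lemma for sequences. One coordinate at a time, pass to a further subsequence
  along which this coordinate is monotone. If it decreases, it is constant from the index of its
  least value on, so dropping a beginning makes it weakly increasing.\<close>

lemma dickson:
  fixes m :: "nat \<Rightarrow> ('n::finite \<Rightarrow>\<^sub>0 nat)"
  shows "\<exists>r::nat \<Rightarrow> nat. strict_mono r \<and> (\<forall>i j. i \<le> j \<longrightarrow> mon_dvd (m (r i)) (m (r j)))"
proof -
  have "\<exists>r. strict_mono r \<and> (\<forall>x\<in>X. incseq (\<lambda>n. lookup (m (r n)) x))" if "finite X" for X :: "'n set"
    using that
  proof (induction X)
    case empty
    show ?case by (rule exI[of _ id]) (simp add: strict_mono_def)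
  next
    case (insert x X)
    then obtain r where r: "strict_mono r" "\<forall>x\<in>X. incseq (\<lambda>n. lookup (m (r n)) x)" by blast
    define s where "s n = lookup (m (r n)) x" for n
    obtain q where q: "strict_mono q" "monoseq (\<lambda>n. s (q n))" using seq_monosub[of s] by blast
    have "\<exists>N. incseq (\<lambda>n. s (q (n + N)))"
    proof (cases "incseq (\<lambda>n. s (q n))")
      case True
      then show ?thesis by (intro exI[of _ 0]) simp
    next
      case False
      then have dec: "decseq (\<lambda>n. s (q n))" using q(2) by (simp add: monoseq_iff)
      obtain N where N: "\<And>n. s (q N) \<le> s (q n)"
        using ex_has_least_nat[of "\<lambda>_. True" 0 "\<lambda>n. s (q n)"] by auto
      have "s (q (n + N)) = s (q N)" for n
        using N decseqD[OF dec, of N "n + N"] by (simp add: antisym)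
      then show ?thesis by (intro exI[of _ N]) (simp add: incseq_def)
    qed
    then obtain N where N: "incseq (\<lambda>n. s (q (n + N)))" by blast
    let ?p = "\<lambda>n. q (n + N)"
    have "strict_mono ?p" using q(1) by (simp add: strict_mono_def)
    then have "strict_mono (\<lambda>n. r (?p n))" using r(1) by (simp add: strict_mono_def)
    moreover have "incseq (\<lambda>n. lookup (m (r (?p n))) y)" if "y \<in> insert x X" for y
    proof (cases "y = x")
      case True
      then show ?thesis using N by (simp add: s_def)
    next
      case False
      then have "incseq (\<lambda>n. lookup (m (r n)) y)" using that r(2) by blast
      then show ?thesis
        by (simp add: incseq_def strict_mono_less_eq[OF q(1)])
    qed
    ultimately show ?case by blast
  qed
  from this[of UNIV] obtain r where "strict_mono r" "\<And>x. incseq (\<lambda>n. lookup (m (r n)) x)" by auto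
  then show ?thesis by (intro exI[of _ r]) (auto simp: mon_dvd_def incseq_def)
qed

text \<open>A monomial order: \<open>mon_key\<close> transports the lexicographic order of
  \<^theory>\<open>HOL-Library.Poly_Mapping\<close>, which needs linearly ordered variables.\<close>

definition mon_key :: "('n::finite \<Rightarrow>\<^sub>0 nat) \<Rightarrow> (nat \<Rightarrow>\<^sub>0 nat)"
  where "mon_key m = (\<Sum>i\<in>UNIV. single (to_nat i) (lookup m i))"

lemma mon_key_add: "mon_key (a + b) = mon_key a + mon_key b"
  by (simp add: mon_key_def lookup_add single_add sum.distrib)

lemma lookup_mon_key: "lookup (mon_key m) (to_nat i) = lookup m i"
proof -
  have "lookup (mon_key m) (to_nat i) = (\<Sum>j\<in>UNIV. if j = i then lookup m i else 0)"
    unfolding mon_key_def lookup_sum by (rule sum.cong) (auto simp: lookup_single when_def)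
  then show ?thesis by simp
qed

lemma mon_key_inject [simp]: "mon_key a = mon_key b \<longleftrightarrow> a = b"
  by (metis lookup_mon_key poly_mapping_eqI)

lemma inj_mon_key: "inj mon_key"
  by (simp add: inj_def)

text \<open>The transported order is compatible with addition, and 0 is its least element because
  exponents are natural numbers.\<close>

lemma mon_key_le_add: "mon_key a \<le> mon_key (a + u)"
proof -
  have "0 \<le> (x :: nat \<Rightarrow>\<^sub>0 nat)" for x
  proof (rule ccontr)
    assume "\<not> 0 \<le> x"
    then have "x < 0" by simp
    then show False by transfer (auto simp: less_fun_def)
  qed
  from add_left_mono[OF this[of "mon_key u"], of "mon_key a"] show ?thesis
    by (simp add: mon_key_add)
qed

lemma mon_dvd_imp_key_le: "mon_dvd a b \<Longrightarrow> mon_key a \<le> mon_key b"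
  unfolding mon_dvd_iff using mon_key_le_add by blast

text \<open>The order on all of \<open>nat \<Rightarrow>\<^sub>0 nat\<close> is not well-founded,
  since the unit vectors form a descending sequence. Finiteness of the set of variables enters
  through \<open>dickson\<close>: in a descending sequence an earlier monomial would divide a later
  one.\<close>

lemma wf_mon_key: "wf {(a, b). mon_key a < mon_key (b :: 'n::finite \<Rightarrow>\<^sub>0 nat)}"
proof (rule ccontr)
  assume "\<not> ?thesis"
  then obtain m :: "nat \<Rightarrow> ('n \<Rightarrow>\<^sub>0 nat)" where m: "\<And>i. mon_key (m (Suc i)) < mon_key (m i)"
    unfolding wf_iff_no_infinite_down_chain by blast
  have dec: "mon_key (m j) < mon_key (m i)" if "i < j" for i j
    using that
  proof (induction rule: less_Suc_induct)
    case (1 i)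
    show ?case by (rule m)
  next
    case (2 i j k)
    from 2(4,3) show ?case by (rule order.strict_trans)
  qed
  obtain r :: "nat \<Rightarrow> nat" where r: "strict_mono r" "\<And>i j. i \<le> j \<Longrightarrow> mon_dvd (m (r i)) (m (r j))"
    using dickson[of m] by blast
  have "mon_key (m (r 0)) \<le> mon_key (m (r 1))"
    by (intro mon_dvd_imp_key_le r(2)) simp
  moreover have "r 0 < r 1" using r(1) by (simp add: strict_mono_def)
  ultimately show False using dec leD by blast
qed

section \<open>Polynomials and leading monomials\<close>

lemma poly_sum_single: "f = (\<Sum>m\<in>keys f. single m (lookup f m))"
proof (rule poly_mapping_eqI)
  fix k
  have "lookup (\<Sum>m\<in>keys f. single m (lookup f m)) k = (\<Sum>m\<in>keys f. if m = k then lookup f k else 0)"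
    unfolding lookup_sum by (rule sum.cong) (auto simp: lookup_single when_def)
  also have "\<dots> = lookup f k" by (auto simp: in_keys_iff)
  finally show "lookup f k = lookup (\<Sum>m\<in>keys f. single m (lookup f m)) k" ..
qed

lemma keys_sum_subset: "keys (sum g A) \<subseteq> (\<Union>x\<in>A. keys (g x))"
proof
  fix k assume "k \<in> keys (sum g A)"
  then have "(\<Sum>x\<in>A. lookup (g x) k) \<noteq> 0" by (simp add: in_keys_iff lookup_sum)
  then obtain x where "x \<in> A" "lookup (g x) k \<noteq> 0" by (rule sum.not_neutral_contains_not_neutral)
  then show "k \<in> (\<Union>x\<in>A. keys (g x))" by (auto simp: in_keys_iff)
qed

lemma keys_eq_empty_iff [simp]: "keys f = {} \<longleftrightarrow> f = 0"
  by (auto intro!: poly_mapping_eqI simp: in_keys_iff set_eq_iff)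

lemma keys_diff_subset: "keys (f - g :: 'a \<Rightarrow>\<^sub>0 'b::ab_group_add) \<subseteq> keys f \<union> keys g"
  by (auto simp: in_keys_iff lookup_minus)

lemma single_mult_sum:
  fixes f :: "('n, 'k::field) mpoly"
  shows "single u c * f = (\<Sum>m\<in>keys f. single (u + m) (c * lookup f m))"
  by (subst (1) poly_sum_single[of f]) (simp add: sum_distrib_left mult_single)

lemma lookup_single_mult [simp]:
  fixes f :: "('n, 'k::field) mpoly"
  shows "lookup (single u c * f) (u + m) = c * lookup f m"
proof -
  have "lookup (single u c * f) (u + m) = (\<Sum>k\<in>keys f. if k = m then c * lookup f m else 0)"
    unfolding single_mult_sum lookup_sum by (rule sum.cong) (auto simp: lookup_single when_def)
  also have "\<dots> = c * lookup f m" by (auto simp: in_keys_iff)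
  finally show ?thesis .
qed

lemma lookup_kscale [simp]: "lookup (kscale c f) m = c * lookup f m"
  using lookup_single_mult[of 0 c f m] by (simp add: kscale_def)

lemma keys_single_mult:
  fixes f :: "('n, 'k::field) mpoly"
  assumes "c \<noteq> 0"
  shows "keys (single u c * f) = (+) u ` keys f"
proof
  show "keys (single u c * f) \<subseteq> (+) u ` keys f"
    unfolding single_mult_sum using keys_sum_subset by (fastforce split: if_splits)
  show "(+) u ` keys f \<subseteq> keys (single u c * f)"
    using assms by (auto simp: in_keys_iff)
qed

lemma keys_kscale: "c \<noteq> 0 \<Longrightarrow> keys (kscale c f) = keys f"
  by (auto simp: in_keys_iff)

text \<open>The maximum is taken among the keys and pulled back, as exponent vectors over
  \<open>'n\<close> carry no order themselves. The value at 0 is unspecified.\<close>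

definition lm :: "('n::finite, 'k::field) mpoly \<Rightarrow> ('n \<Rightarrow>\<^sub>0 nat)"
  where "lm f = the_inv mon_key (Max (mon_key ` keys f))"

lemma mon_key_lm:
  assumes "f \<noteq> 0"
  shows "mon_key (lm f) = Max (mon_key ` keys f)"
proof -
  have "Max (mon_key ` keys f) \<in> mon_key ` keys f"
    using assms by (intro Max_in) auto
  then show ?thesis unfolding lm_def using inj_mon_key by (auto intro: f_the_inv_into_f)
qed

lemma lm_in_keys: "f \<noteq> 0 \<Longrightarrow> lm f \<in> keys f"
  using Max_in[of "mon_key ` keys f"] mon_key_lm[of f, symmetric] by (simp add: inj_image_mem_iff[OF inj_mon_key])

lemma lm_max: "m \<in> keys f \<Longrightarrow> mon_key m \<le> mon_key (lm f)"
  by (subst mon_key_lm) auto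

lemma lm_eqI: "m \<in> keys f \<Longrightarrow> (\<And>k. k \<in> keys f \<Longrightarrow> mon_key k \<le> mon_key m) \<Longrightarrow> lm f = m"
  by (metis antisym lm_in_keys lm_max mon_key_inject keys_eq_empty_iff empty_iff)

lemma lm_single_mult:
  assumes "c \<noteq> 0" "f \<noteq> 0"
  shows "lm (single u c * f) = u + lm f"
  using assms lm_max[of _ f]
  by (intro lm_eqI) (auto simp: keys_single_mult mon_key_add lm_in_keys)

text \<open>The reduction step shared by \<open>no_ascending_ideals\<close> and
  \<open>normal_form\<close>: the common leading term disappears and only smaller monomials
  remain.\<close>

lemma lm_cancel:
  fixes f g :: "('n::finite, 'k::field) mpoly"
  assumes "lm f = lm g" "lookup f (lm f) = lookup g (lm g)" "f - g \<noteq> 0"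
  shows "mon_key (lm (f - g)) < mon_key (lm f)"
proof -
  have "lm (f - g) \<in> keys (f - g)" using assms(3) by (rule lm_in_keys)
  then have "lm (f - g) \<noteq> lm f" using assms by (auto simp: in_keys_iff lookup_minus)
  moreover have "mon_key (lm (f - g)) \<le> mon_key (lm f)"
    using \<open>lm (f - g) \<in> keys (f - g)\<close> keys_diff_subset[of f g] lm_max assms(1) by (metis UnE subsetD)
  ultimately show ?thesis by (simp add: order.strict_iff_order)
qed

text \<open>The coefficient of f * g at \<open>lm f + lm g\<close> is the product of the leading
  coefficients: any other a in \<open>keys f\<close> has a smaller key, so a + b stays strictly
  below for every b in \<open>keys g\<close>.\<close>

lemma mult_nonzero:
  fixes f g :: "('n::finite, 'k::field) mpoly"
  assumes "f \<noteq> 0" "g \<noteq> 0"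
  shows "f * g \<noteq> 0"
proof -
  have "f * g = (\<Sum>a\<in>keys f. single a (lookup f a) * g)"
    by (subst (1) poly_sum_single[of f]) (simp add: sum_distrib_right)
  also have "lookup \<dots> (lm f + lm g) = (\<Sum>a\<in>keys f. if a = lm f then lookup f (lm f) * lookup g (lm g) else 0)"
    unfolding lookup_sum
  proof (rule sum.cong)
    fix a assume a: "a \<in> keys f"
    show "lookup (single a (lookup f a) * g) (lm f + lm g) =
        (if a = lm f then lookup f (lm f) * lookup g (lm g) else 0)"
    proof (cases "a = lm f")
      case False
      then have less: "mon_key a < mon_key (lm f)" using lm_max[OF a] by (simp add: order.strict_iff_order)
      have "lm f + lm g \<notin> (+) a ` keys g"
      proof
        assume "lm f + lm g \<in> (+) a ` keys g"
        then obtain b where b: "b \<in> keys g" "lm f + lm g = a + b" by auto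
        have "mon_key a + mon_key b < mon_key (lm f) + mon_key (lm g)"
          using less lm_max[OF b(1)] by (rule add_less_le_mono)
        then show False using b(2) by (metis mon_key_add order.irrefl)
      qed
      then have "lookup (single a (lookup f a) * g) (lm f + lm g) = 0"
        using keys_single_mult[of "lookup f a" a g] a by (metis in_keys_iff)
      then show ?thesis using False by simp
    qed simp
  qed simp
  also have "\<dots> \<noteq> 0"
    using assms lm_in_keys by (auto simp: in_keys_iff)
  finally show ?thesis by auto
qed

section \<open>Ideals\<close>

lemma is_ideal_iff: "is_ideal I \<longleftrightarrow>
    0 \<in> I \<and> (\<forall>a\<in>I. \<forall>b\<in>I. a + b \<in> I) \<and> (\<forall>c. \<forall>a\<in>I. c * a \<in> I)"
  unfolding is_ideal_def by (simp add: module.subspace_def[OF module_mult])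

context
  fixes I :: "'a::comm_ring_1 set"
  assumes I: "is_ideal I"
begin

lemma ideal_0: "0 \<in> I"
  using I by (simp add: is_ideal_iff)

lemma ideal_add: "a \<in> I \<Longrightarrow> b \<in> I \<Longrightarrow> a + b \<in> I"
  using I by (simp add: is_ideal_iff)

lemma ideal_mult: "a \<in> I \<Longrightarrow> c * a \<in> I"
  using I by (simp add: is_ideal_iff)

lemma ideal_mult2: "a \<in> I \<Longrightarrow> a * c \<in> I"
  using ideal_mult by (simp add: mult.commute)

lemma ideal_uminus: "a \<in> I \<Longrightarrow> - a \<in> I"
  using ideal_mult[of a "- 1"] by simp

lemma ideal_diff: "a \<in> I \<Longrightarrow> b \<in> I \<Longrightarrow> a - b \<in> I"
  using ideal_add[of a "- b"] ideal_uminus by simp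

lemma ideal_sum: "(\<And>x. x \<in> A \<Longrightarrow> g x \<in> I) \<Longrightarrow> sum g A \<in> I"
  by (induction A rule: infinite_finite_induct) (auto intro: ideal_0 ideal_add)

lemma ideal_diff_cancel: "a - b \<in> I \<Longrightarrow> a \<in> I \<longleftrightarrow> b \<in> I"
  using ideal_add[of "a - b" b] ideal_diff[of a "a - b"] by auto

lemma ideal_UNIV_iff: "1 \<in> I \<longleftrightarrow> I = UNIV"
  using ideal_mult[of 1] by auto

lemma is_ideal_colon: "is_ideal (colon I f)"
  unfolding is_ideal_iff colon_def
  using ideal_0 ideal_add ideal_mult by (auto simp: distrib_right mult.assoc)

lemma colon_superset: "I \<subseteq> colon I f"
  by (auto simp: colon_def ideal_mult2)

lemma colon_UNIV_iff: "colon I f = UNIV \<longleftrightarrow> f \<in> I"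
  unfolding colon_def using ideal_mult[of f] mult_1[of f] by (metis UNIV_I mem_Collect_eq UNIV_eq_I)

lemma mem_ideal_gen_insert: "x \<in> ideal_gen (insert f I) \<longleftrightarrow> (\<exists>g. x - g * f \<in> I)"
proof -
  have "module.span (*) I = I"
    using I by (simp add: is_ideal_def module.span_eq_iff[OF module_mult])
  then show ?thesis
    by (simp add: ideal_gen_def module.span_insert[OF module_mult])
qed

end

lemma mem_colon: "g \<in> colon I f \<longleftrightarrow> g * f \<in> I"
  by (simp add: colon_def)

lemma colon_colon: "colon (colon I f) g = colon I (g * f)"
  by (simp add: colon_def mult.assoc)

lemma colon_1: "colon I 1 = I"
  by (simp add: colon_def)

lemma is_ideal_ideal_gen: "is_ideal (ideal_gen L)"
  by (simp add: is_ideal_def ideal_gen_def module.subspace_span[OF module_mult])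

lemma ideal_gen_superset: "L \<subseteq> ideal_gen L"
  by (simp add: ideal_gen_def module.span_superset[OF module_mult])

lemma ideal_gen_minimal: "is_ideal I \<Longrightarrow> L \<subseteq> I \<Longrightarrow> ideal_gen L \<subseteq> I"
  by (simp add: ideal_gen_def is_ideal_def module.span_minimal[OF module_mult])

lemma ideal_gen_insert_absorb: "ideal_gen (insert f (ideal_gen L)) = ideal_gen (insert f L)"
proof
  have "ideal_gen L \<subseteq> ideal_gen (insert f L)"
    using ideal_gen_superset[of "insert f L"] by (intro ideal_gen_minimal is_ideal_ideal_gen) auto
  then show "ideal_gen (insert f (ideal_gen L)) \<subseteq> ideal_gen (insert f L)"
    using ideal_gen_superset[of "insert f L"] by (intro ideal_gen_minimal is_ideal_ideal_gen) auto
  show "ideal_gen (insert f L) \<subseteq> ideal_gen (insert f (ideal_gen L))"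
    using ideal_gen_superset[of "insert f (ideal_gen L)"] ideal_gen_superset[of L]
    by (intro ideal_gen_minimal is_ideal_ideal_gen) auto
qed

lemma kscale_in_ideal: "is_ideal I \<Longrightarrow> f \<in> I \<Longrightarrow> kscale c f \<in> I"
  by (simp add: kscale_def ideal_mult)

section \<open>The polynomial ring is Noetherian\<close>

text \<open>Choose f n in I (n + 1) - I n with minimal leading monomial. By \<open>dickson\<close>,
  \<open>lm (f i)\<close> divides \<open>lm (f j)\<close> for some i < j. Subtracting a suitable
  multiple h of f i, which lies in I j, cancels the leading term of f j without leaving I (j + 1) -
  I j, against minimality.\<close>

lemma no_ascending_ideals:
  fixes I :: "nat \<Rightarrow> ('n::finite, 'k::field) mpoly set"
  assumes ideal: "\<And>n. is_ideal (I n)"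
  shows "\<not> (\<forall>n. I n \<subset> I (Suc n))"
proof
  assume asc: "\<forall>n. I n \<subset> I (Suc n)"
  have mono: "I i \<subseteq> I j" if "i \<le> j" for i j
    using asc that by (intro lift_Suc_mono_le[of I i j] psubset_imp_subset) blast+
  have "\<exists>f. f \<in> I (Suc n) - I n \<and> (\<forall>g\<in>I (Suc n) - I n. \<not> mon_key (lm g) < mon_key (lm f))" for n
  proof -
    obtain f where "f \<in> I (Suc n) - I n" using asc by blast
    then obtain m where m: "m \<in> lm ` (I (Suc n) - I n)"
      "\<And>y. (y, m) \<in> {(a, b). mon_key a < mon_key b} \<Longrightarrow> y \<notin> lm ` (I (Suc n) - I n)"
      using wfE_min[OF wf_mon_key, of "lm f" "lm ` (I (Suc n) - I n)"] by blast
    then show ?thesis by blast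
  qed
  then obtain f where f: "\<And>n. f n \<in> I (Suc n)" "\<And>n. f n \<notin> I n"
    and min: "\<And>n g. g \<in> I (Suc n) \<Longrightarrow> g \<notin> I n \<Longrightarrow> \<not> mon_key (lm g) < mon_key (lm (f n))"
    by (metis Diff_iff)
  have nz: "f n \<noteq> 0" for n using f(2)[of n] ideal_0[OF ideal] by metis
  obtain r :: "nat \<Rightarrow> nat" where r: "strict_mono r" "\<forall>i j. i \<le> j \<longrightarrow> mon_dvd (lm (f (r i))) (lm (f (r j)))"
    using dickson[of "\<lambda>n. lm (f n)"] by blast
  define i j where "i = r 0" and "j = r 1"
  have ij: "i < j" using r(1) by (simp add: i_def j_def strict_mono_def)
  obtain u where u: "lm (f j) = u + lm (f i)"
    using r(2) unfolding i_def j_def mon_dvd_iff by (metis add.commute zero_le)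
  define c where "c = lookup (f j) (lm (f j)) / lookup (f i) (lm (f i))"
  have c: "c \<noteq> 0" using nz lm_in_keys by (auto simp: c_def in_keys_iff)
  define h where "h = single u c * f i"
  have hI: "h \<in> I j"
    unfolding h_def using f(1)[of i] mono[of "Suc i" j] ij ideal by (auto intro: ideal_mult)
  have "lm h = lm (f j)" using u c nz by (simp add: h_def lm_single_mult)
  moreover have "lookup h (lm h) = lookup (f j) (lm (f j))"
    using nz[of i] lm_in_keys[of "f i"] \<open>lm h = lm (f j)\<close>
    by (simp add: u h_def c_def in_keys_iff del: mult_eq_0_iff)
  moreover have nI: "f j - h \<notin> I j"
    using hI f(2) ideal_diff_cancel[OF ideal] by blast
  moreover have "f j - h \<in> I (Suc j)"
    using hI f(1) mono[of j "Suc j"] by (auto intro: ideal_diff[OF ideal])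
  moreover have "f j - h \<noteq> 0" using nI ideal_0[OF ideal] by metis
  ultimately show False
    using lm_cancel[of "f j" h] min[of "f j - h" j] by simp
qed

section \<open>Associated primes as maximal colon ideals\<close>

lemma ex_maximal_ideal:
  fixes F :: "('n::finite, 'k::field) mpoly set set"
  assumes "J \<in> F" "\<And>I. I \<in> F \<Longrightarrow> is_ideal I"
  shows "\<exists>I\<in>F. \<forall>I'\<in>F. \<not> I \<subset> I'"
proof (rule ccontr)
  assume "\<not> ?thesis"
  then have "\<forall>I. \<exists>I'. I \<in> F \<longrightarrow> I' \<in> F \<and> I \<subset> I'" by blast
  then obtain s where s: "\<And>I. I \<in> F \<Longrightarrow> s I \<in> F \<and> I \<subset> s I" by metis
  define c where "c n = (s ^^ n) J" for n
  have "c n \<in> F" for n by (induction n) (auto simp: c_def assms(1) s)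
  then show False
    using no_ascending_ideals[of c] assms(2) s by (auto simp: c_def)
qed

text \<open>A colon ideal maximal among those disjoint from M is prime. If a * b is in (I : f) and
  neither factor is, then (I : a f) is strictly larger, as it contains b, and so contains some c in
  M. Now (I : c f) contains a, so it meets M in some u, and u * c is in (I : f) and in M.\<close>

lemma ex_prime_colon:
  fixes I :: "('n::finite, 'k::field) mpoly set"
  assumes I: "is_ideal I" and M: "1 \<in> M" "\<And>a b. a \<in> M \<Longrightarrow> b \<in> M \<Longrightarrow> a * b \<in> M" "I \<inter> M = {}"
  shows "\<exists>f. prime_ideal (colon I f) \<and> colon I f \<inter> M = {}"
proof -
  let ?F = "{colon I f | f. colon I f \<inter> M = {}}"
  have "I \<in> ?F" using M(3) colon_1[of I] by blast
  then have "\<exists>J\<in>?F. \<forall>J'\<in>?F. \<not> J \<subset> J'"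
    by (rule ex_maximal_ideal) (auto intro: is_ideal_colon I)
  then obtain J where "J \<in> ?F" "\<forall>J'\<in>?F. \<not> J \<subset> J'" by blast
  then obtain f where f: "colon I f \<inter> M = {}" and "\<forall>J'\<in>?F. \<not> colon I f \<subset> J'" by auto
  then have max: "\<not> colon I f \<subset> colon I g" if "colon I g \<inter> M = {}" for g using that by blast
  have ideal: "is_ideal (colon I f)" by (rule is_ideal_colon[OF I])
  have meets: "colon I (a * f) \<inter> M \<noteq> {}" if "b \<notin> colon I f" "b \<in> colon I (a * f)" for a b
    using that max[of "a * f"] colon_superset[OF ideal, of a] by (auto simp: colon_colon)
  have "prime_ideal (colon I f)"
    unfolding prime_ideal_def
  proof (intro conjI allI impI)
    show "colon I f \<noteq> UNIV" using f M(1) by blast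
    fix a b assume ab: "a * b \<in> colon I f"
    show "a \<in> colon I f \<or> b \<in> colon I f"
    proof (rule ccontr)
      assume *: "\<not> ?thesis"
      have "b \<in> colon I (a * f)" using ab by (simp add: colon_def algebra_simps)
      then obtain c where c: "c \<in> M" "c * (a * f) \<in> I" using meets * by (auto simp: colon_def)
      then have "a \<in> colon I (c * f)" by (simp add: colon_def algebra_simps)
      then obtain u where u: "u \<in> M" "u * (c * f) \<in> I" using meets * by (auto simp: colon_def)
      then have "u * c \<in> colon I f \<inter> M" using c M(2) by (simp add: colon_def mult.assoc)
      then show False using f by blast
    qed
  qed (rule ideal)
  then show ?thesis using f by blast
qed

text \<open>M acts as the set of denominators of a localization. It is used with M = {1} to find an
  associated prime above a proper colon ideal, with the complement of a prime Q to find one inside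
  Q, and with K[T] - {0} to bound the dimension of cones.\<close>

lemma ex_Ass_colon:
  fixes I :: "('n::finite, 'k::field) mpoly set"
  assumes "is_ideal I" "1 \<in> M" "\<And>a b. a \<in> M \<Longrightarrow> b \<in> M \<Longrightarrow> a * b \<in> M" "colon I g \<inter> M = {}"
  shows "\<exists>P\<in>Ass I. colon I g \<subseteq> P \<and> P \<inter> M = {}"
proof -
  obtain f where "prime_ideal (colon (colon I g) f)" "colon (colon I g) f \<inter> M = {}"
    using ex_prime_colon[OF is_ideal_colon[OF assms(1)] assms(2,3,4)] by blast
  then show ?thesis
    using colon_superset[OF is_ideal_colon[OF assms(1)], of g f] by (auto simp: colon_colon Ass_def)
qed

lemma ex_Ass_below_prime:
  fixes I :: "('n::finite, 'k::field) mpoly set"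
  assumes I: "is_ideal I" and Q: "prime_ideal Q" "I \<subseteq> Q"
  shows "\<exists>P\<in>Ass I. P \<subseteq> Q"
proof -
  have "1 \<in> - Q" using Q ideal_UNIV_iff[of Q] by (auto simp: prime_ideal_def)
  then have "\<exists>P\<in>Ass I. colon I 1 \<subseteq> P \<and> P \<inter> - Q = {}"
    using Q by (intro ex_Ass_colon I) (auto simp: prime_ideal_def colon_1)
  then show ?thesis by blast
qed

lemma Ass_superset: "is_ideal I \<Longrightarrow> P \<in> Ass I \<Longrightarrow> I \<subseteq> P"
  using colon_superset by (auto simp: Ass_def)

section \<open>Homogeneous components\<close>

lemma lookup_hom_component: "lookup (hom_component d f) m = (if mon_deg m = d then lookup f m else 0)"
proof -
  let ?A = "{m \<in> keys f. mon_deg m = d}"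
  have "lookup (hom_component d f) m = (\<Sum>k\<in>?A. if k = m then lookup f m else 0)"
    unfolding hom_component_def lookup_sum by (rule sum.cong) (auto simp: lookup_single when_def)
  also have "\<dots> = (if mon_deg m = d then lookup f m else 0)"
    by (auto simp: in_keys_iff)
  finally show ?thesis .
qed

lemma hom_component_diff: "hom_component d (f - g) = hom_component d f - hom_component d g"
  by (rule poly_mapping_eqI) (simp add: lookup_hom_component lookup_minus)

lemma hom_component_sum: "hom_component d (sum g A) = (\<Sum>x\<in>A. hom_component d (g x))"
  by (rule poly_mapping_eqI) (simp add: lookup_hom_component lookup_sum)

lemma keys_hom_component: "keys (hom_component d f) = {m \<in> keys f. mon_deg m = d}"
  by (auto simp: in_keys_iff lookup_hom_component split: if_splits)

lemma hom_component_in_forms: "hom_component d f \<in> forms d"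
  by (simp add: forms_def keys_hom_component)

lemma hom_component_forms: "f \<in> forms e \<Longrightarrow> hom_component d f = (if d = e then f else 0)"
  by (rule poly_mapping_eqI) (auto simp: lookup_hom_component forms_def in_keys_iff)

lemma sum_hom_components: "f = (\<Sum>d\<in>mon_deg ` keys f. hom_component d f)"
proof (rule poly_mapping_eqI)
  fix m
  show "lookup f m = lookup (\<Sum>d\<in>mon_deg ` keys f. hom_component d f) m"
    by (auto simp: lookup_sum lookup_hom_component in_keys_iff)
qed

lemma forms_0 [simp]: "0 \<in> forms d"
  by (simp add: forms_def)

lemma forms_add: "f \<in> forms d \<Longrightarrow> g \<in> forms d \<Longrightarrow> f + g \<in> forms d"
  using keys_add[of f g] by (auto simp: forms_def)

lemma forms_diff: "f \<in> forms d \<Longrightarrow> g \<in> forms d \<Longrightarrow> f - g \<in> forms d"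
  using keys_diff_subset[of f g] by (auto simp: forms_def)

lemma single_in_forms: "mon_deg m = d \<Longrightarrow> single m c \<in> forms d"
  by (auto simp: forms_def split: if_splits)

lemma kscale_in_forms: "f \<in> forms d \<Longrightarrow> kscale c f \<in> forms d"
  by (auto simp: forms_def in_keys_iff)

lemma single_mult_in_forms:
  fixes f :: "('n::finite, 'k::field) mpoly"
  assumes "f \<in> forms e"
  shows "single u c * f \<in> forms (mon_deg u + e)"
  using assms by (cases "c = 0") (auto simp: forms_def keys_single_mult mon_deg_add)

text \<open>Each term of g times f is again a form, with degree raised by e, so collecting the terms
  of degree d gives the claim. The case distinction guards the truncated difference
  \<open>d - e\<close>.\<close>

lemma hom_component_mult:
  fixes f g :: "('n::finite, 'k::field) mpoly"
  assumes "f \<in> forms e"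
  shows "hom_component d (g * f) = (if e \<le> d then hom_component (d - e) g * f else 0)"
proof -
  have "hom_component d (g * f) = (\<Sum>u\<in>keys g. hom_component d (single u (lookup g u) * f))"
    by (subst (1) poly_sum_single[of g]) (simp add: sum_distrib_right hom_component_sum)
  also have "\<dots> = (\<Sum>u\<in>keys g. if mon_deg u + e = d then single u (lookup g u) * f else 0)"
    by (rule sum.cong) (auto simp: hom_component_forms[OF single_mult_in_forms[OF assms]])
  also have "\<dots> = (\<Sum>u\<in>{u\<in>keys g. mon_deg u + e = d}. single u (lookup g u) * f)"
    by (rule sum.mono_neutral_cong_right) auto
  also have "\<dots> = (if e \<le> d then hom_component (d - e) g * f else 0)"
  proof (cases "e \<le> d")
    case True
    then have "{u\<in>keys g. mon_deg u + e = d} = {u\<in>keys g. mon_deg u = d - e}" by auto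
    then show ?thesis using True by (simp add: hom_component_def sum_distrib_right)
  next
    case False
    then have "{u\<in>keys g. mon_deg u + e = d} = {}" by auto
    then show ?thesis using False by simp
  qed
  finally show ?thesis .
qed

lemma mult_in_forms:
  fixes f g :: "('n::finite, 'k::field) mpoly"
  assumes "f \<in> forms e" "g \<in> forms d"
  shows "g * f \<in> forms (d + e)"
  using hom_component_mult[OF assms(1), of "d + e" g] hom_component_in_forms[of "d + e" "g * f"]
  by (simp add: hom_component_forms[OF assms(2)])

lemma graded_imp_ideal: "graded_ideal I \<Longrightarrow> is_ideal I"
  by (simp add: graded_ideal_def)

lemma graded_hom_component: "graded_ideal I \<Longrightarrow> f \<in> I \<Longrightarrow> hom_component d f \<in> I"
  by (simp add: graded_ideal_def)

lemma graded_colon: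
  fixes I :: "('n::finite, 'k::field) mpoly set"
  assumes I: "graded_ideal I" and f: "f \<in> forms e"
  shows "graded_ideal (colon I f)"
  unfolding graded_ideal_def
proof (intro conjI ballI allI)
  show "is_ideal (colon I f)" using I by (simp add: graded_ideal_def is_ideal_colon)
  fix g d assume "g \<in> colon I f"
  then have "hom_component (d + e) (g * f) \<in> I"
    using I by (simp add: graded_ideal_def colon_def)
  then show "hom_component d g \<in> colon I f"
    by (simp add: hom_component_mult[OF f] colon_def)
qed

lemma graded_insert:
  fixes I :: "('n::finite, 'k::field) mpoly set"
  assumes I: "graded_ideal I" and f: "f \<in> forms e"
  shows "graded_ideal (ideal_gen (insert f I))"
  unfolding graded_ideal_def
proof (intro conjI ballI allI)
  show "is_ideal (ideal_gen (insert f I))" by (rule is_ideal_ideal_gen)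
  note mem = mem_ideal_gen_insert[OF graded_imp_ideal[OF I]]
  fix x d assume "x \<in> ideal_gen (insert f I)"
  then obtain g where "x - g * f \<in> I" using mem by blast
  then have "hom_component d x - hom_component d (g * f) \<in> I"
    using I by (auto simp: graded_ideal_def simp flip: hom_component_diff)
  then have "hom_component d x - (if e \<le> d then hom_component (d - e) g else 0) * f \<in> I"
    by (simp add: hom_component_mult[OF f] split: if_splits)
  then show "hom_component d x \<in> ideal_gen (insert f I)" unfolding mem by blast
qed

lemma graded_linear:
  fixes L :: "('n::finite, 'k::field) mpoly set"
  assumes "L \<subseteq> forms 1"
  shows "graded_ideal (ideal_gen L)"
  unfolding graded_ideal_def
proof (intro conjI ballI allI)
  show "is_ideal (ideal_gen L)" by (rule is_ideal_ideal_gen)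
  fix x d assume "x \<in> ideal_gen L"
  then obtain t r where "finite t" "t \<subseteq> L" and x: "x = (\<Sum>a\<in>t. r a * a)"
    unfolding ideal_gen_def module.span_explicit[OF module_mult] by auto
  have "hom_component d (r a * a) \<in> ideal_gen L" if "a \<in> t" for a
  proof -
    have a: "a \<in> forms 1" "a \<in> ideal_gen L"
      using that \<open>t \<subseteq> L\<close> assms ideal_gen_superset[of L] by auto
    show ?thesis unfolding hom_component_mult[OF a(1)]
      using a(2) by (auto intro: ideal_mult ideal_0 is_ideal_ideal_gen)
  qed
  then show "hom_component d x \<in> ideal_gen L"
    unfolding x hom_component_sum by (intro ideal_sum is_ideal_ideal_gen)
qed

section \<open>Standard monomials and Hilbert functions\<close>

text \<open>The exponents outside the initial ideal of J. Their monomials represent a K-basis of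
  S/J: \<open>Std_unique\<close> gives independence and \<open>normal_form\<close>
  generation.\<close>

definition Std :: "('n::finite, 'k::field) mpoly set \<Rightarrow> ('n \<Rightarrow>\<^sub>0 nat) set"
  where "Std J = {m. \<forall>f\<in>J. f \<noteq> 0 \<longrightarrow> lm f \<noteq> m}"

lemma Std_antimono: "J \<subseteq> J' \<Longrightarrow> Std J' \<subseteq> Std J"
  by (auto simp: Std_def)

lemma Std_mon_dvd:
  assumes J: "is_ideal J" and "b \<in> Std J" "mon_dvd a b"
  shows "a \<in> Std J"
proof -
  obtain u where u: "b = u + a" using assms(3) by (auto simp: mon_dvd_iff add.commute)
  have "lm f \<noteq> a" if "f \<in> J" "f \<noteq> 0" for f
  proof
    assume "lm f = a"
    then have "lm (single u 1 * f) = b" using that u by (simp add: lm_single_mult)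
    moreover have "single u 1 * f \<in> J" using J that by (simp add: ideal_mult)
    moreover have "single u 1 * f \<noteq> 0"
      using that keys_single_mult[of 1 u f] keys_eq_empty_iff by (metis image_is_empty one_neq_zero)
    ultimately show False using assms(2) by (auto simp: Std_def)
  qed
  then show ?thesis by (auto simp: Std_def)
qed

lemma Std_unique: "w \<in> J \<Longrightarrow> keys w \<subseteq> Std J \<Longrightarrow> w = 0"
  using lm_in_keys by (fastforce simp: Std_def)

text \<open>Division with remainder, by well-founded induction on the leading monomial m of v. If m
  is standard, the leading term is moved into the remainder; otherwise a scalar multiple of an
  element of J with leading monomial m cancels it. The case v = 0 is treated apart because
  \<open>lm 0\<close> carries no information.\<close>

lemma normal_form:
  fixes J :: "('n::finite, 'k::field) mpoly set"
  assumes J: "is_ideal J"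
  shows "\<exists>w. keys w \<subseteq> Std J \<and> v - w \<in> J"
proof -
  have "\<forall>v. lm v = m \<longrightarrow> (\<exists>w. keys w \<subseteq> Std J \<and> v - w \<in> J)" for m
  proof (induction m rule: wf_induct[OF wf_mon_key])
    case (1 m)
    have IH: "\<exists>w. keys w \<subseteq> Std J \<and> v - w \<in> J" if "mon_key (lm v) < mon_key m" for v
      using 1 that by simp
    show ?case
    proof (intro allI impI)
      fix v :: "('n, 'k) mpoly" assume m: "lm v = m"
      have zero: "\<exists>w. keys w \<subseteq> Std J \<and> v - w \<in> J" if "v = 0" for v
        using that ideal_0[OF J] by (intro exI[of _ 0]) simp
      show "\<exists>w. keys w \<subseteq> Std J \<and> v - w \<in> J"
      proof (cases "v = 0")
        case False
        define c where "c = lookup v m"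
        have c: "c \<noteq> 0" using lm_in_keys[OF False] by (auto simp: c_def m in_keys_iff)
        have step: "\<exists>w. keys w \<subseteq> Std J \<and> (v - g) - w \<in> J" if "lm g = m" "lookup g m = c" for g
        proof (cases "v - g = 0")
          case False
          then show ?thesis using that m by (intro IH lm_cancel[of v g, unfolded m]) (auto simp: c_def)
        qed (rule zero)
        show ?thesis
        proof (cases "m \<in> Std J")
          case True
          have "lm (single m c) = m" using c by (intro lm_eqI) auto
          then obtain w where w: "keys w \<subseteq> Std J" "(v - single m c) - w \<in> J"
            using step[of "single m c"] by auto
          have "keys (single m c + w) \<subseteq> Std J"
            using keys_add[of "single m c" w] w(1) c True by auto
          then show ?thesis using w(2) by (intro exI[of _ "single m c + w"]) (simp add: algebra_simps)
        next
          case False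
          then obtain g where g: "g \<in> J" "g \<noteq> 0" "lm g = m" by (auto simp: Std_def)
          define b where "b = lookup g m"
          have b: "b \<noteq> 0" using lm_in_keys[OF g(2)] by (auto simp: b_def g(3) in_keys_iff)
          have "lm (kscale (c / b) g) = m"
            using b c g by (simp add: kscale_def lm_single_mult)
          moreover have "lookup (kscale (c / b) g) m = c" using b by (simp add: b_def)
          ultimately obtain w where w: "keys w \<subseteq> Std J" "(v - kscale (c / b) g) - w \<in> J"
            using step by blast
          have "(v - kscale (c / b) g - w) + kscale (c / b) g \<in> J"
            by (intro ideal_add J w kscale_in_ideal g)
          then show ?thesis using w(1) by (auto simp: algebra_simps)
        qed
      qed (rule zero)
    qed
  qed
  then show ?thesis by blast
qed

text \<open>The lexicographic order does not compare degrees first, so homogeneity is imposed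
  afterwards: v is a form and J is graded, hence the component of degree d of a remainder is still
  congruent to v.\<close>

lemma normal_form_forms:
  fixes J :: "('n::finite, 'k::field) mpoly set"
  assumes J: "graded_ideal J" and v: "v \<in> forms d"
  shows "\<exists>w\<in>forms d. keys w \<subseteq> Std J \<and> v - w \<in> J"
proof -
  obtain w where w: "keys w \<subseteq> Std J" "v - w \<in> J"
    using normal_form[OF graded_imp_ideal[OF J]] by blast
  from graded_hom_component[OF J w(2), of d] have "v - hom_component d w \<in> J"
    by (simp add: hom_component_diff hom_component_forms[OF v])
  then show ?thesis using w(1) by (intro bexI[of _ "hom_component d w"])
    (auto simp: keys_hom_component hom_component_in_forms)
qed

section \<open>Bases of quotient spaces and additivity of dimensions\<close>

lemma module_kscale: "module (kscale :: 'k::field \<Rightarrow> ('n, 'k) mpoly \<Rightarrow> ('n, 'k) mpoly)"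
  using vector_space_kscale by (simp add: module_iff_vector_space)

lemmas kscale_subspace_def = module.subspace_def[OF module_kscale]

lemma subspace_ideal: "is_ideal J \<Longrightarrow> module.subspace kscale J"
  unfolding kscale_subspace_def by (auto intro: ideal_0 ideal_add kscale_in_ideal)

lemma subspace_forms: "module.subspace kscale (forms d)"
  unfolding kscale_subspace_def by (auto intro: forms_add kscale_in_forms)

lemma subspace_Int:
  "module.subspace kscale V \<Longrightarrow> module.subspace kscale W \<Longrightarrow> module.subspace kscale (V \<inter> W)"
  unfolding kscale_subspace_def by auto

lemma subspace_sum_kscale:
  assumes "module.subspace kscale V" "\<And>x. x \<in> A \<Longrightarrow> g x \<in> V"
  shows "(\<Sum>x\<in>A. kscale (c x) (g x)) \<in> V"
  using assms(2) by (induction A rule: infinite_finite_induct)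
    (use assms(1) in \<open>auto simp: kscale_subspace_def\<close>)

lemma kscale_single: "kscale c (single m 1) = single m c"
  by (simp add: kscale_def mult_single)

lemma lm_single: "c \<noteq> 0 \<Longrightarrow> lm (single m c) = m"
  by (rule lm_eqI) auto

text \<open>Independence holds since a combination of standard monomials lying in J vanishes;
  generation is the hypothesis \<open>nf\<close>. It serves the pairs (forms of degree d, their part
  in J) and (S, J).\<close>

lemma quot_basis_Std:
  fixes J :: "('n::finite, 'k::field) mpoly set"
  assumes A: "finite A" "A \<subseteq> Std J" "(\<lambda>m. single m 1) ` A \<subseteq> V" and W: "W \<subseteq> J"
    and nf: "\<And>v. v \<in> V \<Longrightarrow> \<exists>w. keys w \<subseteq> A \<and> v - w \<in> W"
  shows "quot_basis V W ((\<lambda>m. single m 1) ` A)"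
proof -
  have inj: "inj_on (\<lambda>m. single m (1::'k)) A"
    by (rule inj_onI) (metis lookup_single_eq lookup_single_not_eq zero_neq_one)
  have red: "(\<Sum>b\<in>(\<lambda>m. single m (1::'k)) ` A. kscale (c b) b) = (\<Sum>m\<in>A. single m (c (single m 1)))" for c
    by (simp add: sum.reindex[OF inj] kscale_single)
  have look: "lookup (\<Sum>m\<in>A. single m (h m)) k = (if k \<in> A then h k else 0)" for k and h :: "_ \<Rightarrow> 'k"
  proof -
    have "lookup (\<Sum>m\<in>A. single m (h m)) k = (\<Sum>m\<in>A. if m = k then h k else 0)"
      unfolding lookup_sum by (rule sum.cong) (auto simp: lookup_single when_def)
    then show ?thesis using A(1) by simp
  qed
  show ?thesis
    unfolding quot_basis_def red
  proof (intro conjI allI impI ballI)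
    fix c :: "('n, 'k) mpoly \<Rightarrow> 'k" and b
    assume c: "(\<Sum>m\<in>A. single m (c (single m 1))) \<in> W" and b: "b \<in> (\<lambda>m. single m (1::'k)) ` A"
    have "keys (\<Sum>m\<in>A. single m (c (single m 1))) \<subseteq> Std J"
      using A(2) by (auto simp: in_keys_iff look split: if_splits)
    then have "(\<Sum>m\<in>A. single m (c (single m 1))) = 0"
      using c W by (intro Std_unique) auto
    then have "k \<in> A \<Longrightarrow> c (single k 1) = 0" for k
      using look[of "\<lambda>m. c (single m 1)" k] by simp
    then show "c b = 0" using b by blast
  next
    fix v assume "v \<in> V"
    then obtain w where w: "keys w \<subseteq> A" "v - w \<in> W" using nf by blast
    \<comment> \<open>\<open>quot_basis\<close> indexes coefficients by the basis polynomials
      instead of exponents; \<open>lm\<close> recovers m from \<open>single m 1\<close>.\<close>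
    have "(\<Sum>m\<in>A. single m (lookup w (lm (single m (1::'k))))) = w"
      using w(1) by (intro poly_mapping_eqI) (auto simp: look in_keys_iff lm_single)
    then have "v - (\<Sum>m\<in>A. single m (lookup w (lm (single m (1::'k))))) \<in> W"
      using w(2) by simp
    then show "\<exists>c. v - (\<Sum>m\<in>A. single m (c (single m (1::'k)))) \<in> W"
      by (intro exI[of _ "\<lambda>x. lookup w (lm x)"])
  qed (use A in auto)
qed

abbreviation Std_deg :: "('n::finite, 'k::field) mpoly set \<Rightarrow> nat \<Rightarrow> ('n \<Rightarrow>\<^sub>0 nat) set"
  where "Std_deg J d \<equiv> {m \<in> Std J. mon_deg m = d}"

lemma finite_Std_deg: "finite (Std_deg J d)"
  using finite_mon_deg[of d] by (rule finite_subset[rotated]) auto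

lemma card_single_image: "card ((\<lambda>m. single m (1::'k::zero_neq_one)) ` A) = card A"
  by (rule card_image, rule inj_onI) (metis lookup_single_eq lookup_single_not_eq zero_neq_one)

lemma quot_basis_forms:
  fixes J :: "('n::finite, 'k::field) mpoly set"
  assumes J: "graded_ideal J"
  shows "quot_basis (forms d) (J \<inter> forms d) ((\<lambda>m. single m 1) ` Std_deg J d)"
proof (rule quot_basis_Std)
  fix v :: "('n, 'k) mpoly" assume v: "v \<in> forms d"
  then obtain w where "w \<in> forms d" "keys w \<subseteq> Std J" "v - w \<in> J" using normal_form_forms[OF J] by blast
  then show "\<exists>w. keys w \<subseteq> Std_deg J d \<and> v - w \<in> J \<inter> forms d"
    using v forms_diff[OF v, of w] by (intro exI[of _ w]) (auto simp: forms_def)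
qed (use finite_Std_deg in \<open>auto intro: single_in_forms\<close>)

lemma hilbert_fun_Std:
  "graded_ideal J \<Longrightarrow> hilbert_fun J d = card (Std_deg (J :: ('n::finite, 'k::field) mpoly set) d)"
  unfolding hilbert_fun_def
  by (subst quot_dim_eq[OF _ quot_basis_forms])
    (auto simp: card_single_image intro: subspace_Int subspace_ideal subspace_forms graded_imp_ideal)

lemma quot_basis_UNIV:
  fixes J :: "('n::finite, 'k::field) mpoly set"
  assumes "is_ideal J" "finite (Std J)"
  shows "quot_basis UNIV J ((\<lambda>m. single m 1) ` Std J)"
  by (rule quot_basis_Std) (use assms normal_form in auto)

lemma quot_dim_Std:
  "is_ideal J \<Longrightarrow> finite (Std J) \<Longrightarrow> quot_dim UNIV J = card (Std (J :: ('n::finite, 'k::field) mpoly set))"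
  by (subst quot_dim_eq[OF subspace_ideal quot_basis_UNIV]) (auto simp: card_single_image)

text \<open>Additivity of the dimension along
  \<open>0 \<rightarrow> V'/W' \<rightarrow> V/W \<rightarrow> V/Wf \<rightarrow> 0\<close>, the first map being multiplication by \<open>f\<close>.\<close>

lemma quot_dim_exact:
  fixes f :: "('n::finite, 'k::field) mpoly"
  assumes V: "module.subspace kscale V" and V': "module.subspace kscale V'"
    and W: "module.subspace kscale W"
    and B: "quot_basis V' W' B" and C: "quot_basis V Wf C"
    and mult: "\<And>v. v \<in> V' \<Longrightarrow> v * f \<in> V"
    and W': "\<And>v. v \<in> V' \<Longrightarrow> v \<in> W' \<longleftrightarrow> v * f \<in> W"
    and Wf: "\<And>x. x \<in> V \<Longrightarrow> x \<in> Wf \<longleftrightarrow> (\<exists>v\<in>V'. x - v * f \<in> W)"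
  shows "quot_dim V W = card B + card C"
proof -
  interpret vector_space "kscale :: 'k \<Rightarrow> ('n, 'k) mpoly \<Rightarrow> ('n, 'k) mpoly"
    by (rule vector_space_kscale)
  have fin: "finite B" "finite C" and sub: "B \<subseteq> V'" "C \<subseteq> V"
    and indB: "\<And>c b. (\<Sum>b\<in>B. kscale (c b) b) \<in> W' \<Longrightarrow> b \<in> B \<Longrightarrow> c b = 0"
    and indC: "\<And>c b. (\<Sum>b\<in>C. kscale (c b) b) \<in> Wf \<Longrightarrow> b \<in> C \<Longrightarrow> c b = 0"
    and spanB: "\<And>v. v \<in> V' \<Longrightarrow> \<exists>c. v - (\<Sum>b\<in>B. kscale (c b) b) \<in> W'"
    and spanC: "\<And>v. v \<in> V \<Longrightarrow> \<exists>c. v - (\<Sum>b\<in>C. kscale (c b) b) \<in> Wf"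
    using B C unfolding quot_basis_def by blast+
  have SB: "(\<Sum>b\<in>B. kscale (c b) b) \<in> V'" for c using V' sub by (intro subspace_sum_kscale) auto
  have SC: "(\<Sum>b\<in>C. kscale (c b) b) \<in> V" for c using V sub by (intro subspace_sum_kscale) auto
  have SBf: "(\<Sum>b\<in>B. kscale (c b) (b * f)) = (\<Sum>b\<in>B. kscale (c b) b) * f" for c
    by (simp add: kscale_def sum_distrib_right mult.assoc)
  have W0: "0 \<in> W" using W by (simp add: subspace_0)
  have one: "(\<Sum>x\<in>A. kscale (if x = b then 1 else 0) (g x)) = g b" if "finite A" "b \<in> A"
    for A b and g :: "('n, 'k) mpoly \<Rightarrow> ('n, 'k) mpoly"
  proof -
    have "(\<Sum>x\<in>A. kscale (if x = b then 1 else 0) (g x)) = (\<Sum>x\<in>A. if x = b then g b else 0)"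
      by (rule sum.cong) auto
    then show ?thesis using that by simp
  qed
  have inj: "inj_on (\<lambda>b. b * f) B"
  proof (rule inj_onI, rule ccontr)
    fix x y assume xy: "x \<in> B" "y \<in> B" "x * f = y * f" "x \<noteq> y"
    let ?c = "\<lambda>z. (if z = x then 1 else 0) - (if z = y then 1 else 0)"
    have "(\<Sum>b\<in>B. kscale (?c b) b) = x - y"
      unfolding scale_left_diff_distrib sum_subtractf
      using one[of B x id] one[of B y id] fin xy by (simp only: id_def)
    moreover have "(x - y) * f \<in> W" using xy W0 by (simp add: left_diff_distrib)
    ultimately have "(\<Sum>b\<in>B. kscale (?c b) b) \<in> W'" using W' SB[of ?c] by simp
    from indB[OF this xy(1)] xy show False by simp
  qed
  have disj: "(\<lambda>b. b * f) ` B \<inter> C = {}"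
  proof (rule ccontr)
    assume "\<not> ?thesis"
    then obtain b where b: "b \<in> B" "b * f \<in> C" by blast
    have "b * f \<in> Wf"
      using Wf[of "b * f"] b sub W0 by (intro iffD2[OF Wf] bexI[of _ b]) auto
    then have "(\<Sum>x\<in>C. kscale (if x = b * f then 1 else 0) x) \<in> Wf"
      using one[of C "b * f" id] fin b by simp
    from indC[OF this b(2)] show False by simp
  qed
  \<comment> \<open>The usual basis of the middle term: the images of a basis of the subspace
    together with lifts of a basis of the quotient.\<close>
  let ?D = "(\<lambda>b. b * f) ` B \<union> C"
  have SD: "(\<Sum>x\<in>?D. kscale (c x) x)
      = (\<Sum>b\<in>B. kscale (c (b * f)) b) * f + (\<Sum>x\<in>C. kscale (c x) x)" for c
    using fin disj by (subst sum.union_disjoint) (auto simp: sum.reindex[OF inj] SBf)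
  have "quot_basis V W ?D"
    unfolding quot_basis_def SD
  proof (intro conjI allI impI ballI)
    fix c x
    let ?b = "\<Sum>b\<in>B. kscale (c (b * f)) b" and ?c = "\<Sum>x\<in>C. kscale (c x) x"
    assume c: "?b * f + ?c \<in> W" and x: "x \<in> ?D"
    have "- ?b \<in> V'" by (rule subspace_neg[OF V' SB])
    moreover have "?c - (- ?b) * f \<in> W" using c by (simp add: algebra_simps)
    ultimately have "?c \<in> Wf" by (intro iffD2[OF Wf[OF SC]] bexI[of _ "- ?b"])
    then have C0: "\<And>x. x \<in> C \<Longrightarrow> c x = 0" by (rule indC)
    then have "?c = 0" by simp
    then have "?b \<in> W'" using c W'[OF SB] by simp
    then show "c x = 0" using x C0 indB[of "\<lambda>b. c (b * f)"] by auto
  next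
    fix v assume v: "v \<in> V"
    obtain c where c: "v - (\<Sum>b\<in>C. kscale (c b) b) \<in> Wf" using spanC[OF v] by blast
    moreover have "v - (\<Sum>b\<in>C. kscale (c b) b) \<in> V" by (rule subspace_diff[OF V v SC])
    ultimately obtain v' where v': "v' \<in> V'" "v - (\<Sum>b\<in>C. kscale (c b) b) - v' * f \<in> W"
      using Wf by blast
    obtain b where b: "v' - (\<Sum>x\<in>B. kscale (b x) x) \<in> W'" using spanB[OF v'(1)] by blast
    have "v' - (\<Sum>x\<in>B. kscale (b x) x) \<in> V'" by (rule subspace_diff[OF V' v'(1) SB])
    then have "(v' - (\<Sum>x\<in>B. kscale (b x) x)) * f \<in> W" using b W' by blast
    from subspace_add[OF W v'(2) this]
    have *: "v - ((\<Sum>x\<in>B. kscale (b x) x) * f + (\<Sum>b\<in>C. kscale (c b) b)) \<in> W"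
      by (simp add: algebra_simps)
    \<comment> \<open>Coefficients are functions on polynomials, so those of the image part are read
      back through the inverse of multiplication by f. Disjointness of the two parts makes the
      definition consistent.\<close>
    define e where "e x = (if x \<in> C then c x else b (the_inv_into B (\<lambda>b. b * f) x))" for x
    have "(\<Sum>x\<in>B. kscale (e (x * f)) x) = (\<Sum>x\<in>B. kscale (b x) x)"
      using disj by (intro sum.cong) (auto simp: e_def the_inv_into_f_f[OF inj])
    moreover have "(\<Sum>x\<in>C. kscale (e x) x) = (\<Sum>x\<in>C. kscale (c x) x)"
      by (intro sum.cong) (auto simp: e_def)
    ultimately show "\<exists>e. v - ((\<Sum>x\<in>B. kscale (e (x * f)) x) * f + (\<Sum>x\<in>C. kscale (e x) x)) \<in> W"
      using * by (intro exI[of _ e]) simp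
  qed (use fin sub mult in auto)
  from quot_dim_eq[OF W this] show ?thesis
    using fin disj by (simp add: card_Un_disjoint card_image[OF inj])
qed

lemma hilbert_fun_exact:
  fixes J :: "('n::finite, 'k::field) mpoly set"
  assumes J: "graded_ideal J" and f: "f \<in> forms e"
  shows "card (Std_deg J (d + e)) =
    card (Std_deg (colon J f) d) + card (Std_deg (ideal_gen (insert f J)) (d + e))"
proof -
  have "quot_dim (forms (d + e)) (J \<inter> forms (d + e)) =
    card ((\<lambda>m. single m (1::'k)) ` Std_deg (colon J f) d) +
    card ((\<lambda>m. single m (1::'k)) ` Std_deg (ideal_gen (insert f J)) (d + e))"
  proof (rule quot_dim_exact[where f = f, OF _ _ _ quot_basis_forms quot_basis_forms])
    fix x :: "('n, 'k) mpoly" assume x: "x \<in> forms (d + e)"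
    show "x \<in> ideal_gen (insert f J) \<inter> forms (d + e) \<longleftrightarrow> (\<exists>v\<in>forms d. x - v * f \<in> J \<inter> forms (d + e))"
    proof
      assume "x \<in> ideal_gen (insert f J) \<inter> forms (d + e)"
      then obtain g where "x - g * f \<in> J"
        using mem_ideal_gen_insert[OF graded_imp_ideal[OF J]] by blast
      \<comment> \<open>Comparing components of degree d + e replaces g by its component of degree
        d, as f has degree e.\<close>
      from graded_hom_component[OF J this, of "d + e"]
      have "x - hom_component d g * f \<in> J"
        by (simp add: hom_component_diff hom_component_mult[OF f] hom_component_forms[OF x])
      then show "\<exists>v\<in>forms d. x - v * f \<in> J \<inter> forms (d + e)"
        using x f by (intro bexI[of _ "hom_component d g"])
          (auto intro: forms_diff mult_in_forms hom_component_in_forms)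
    qed (use x mem_ideal_gen_insert[OF graded_imp_ideal[OF J]] in blast)
  qed (use J f in \<open>auto intro: subspace_Int subspace_forms subspace_ideal graded_imp_ideal graded_colon
        graded_insert mult_in_forms simp: mem_colon\<close>)
  then show ?thesis
    using hilbert_fun_Std[OF J, of "d + e"] by (simp add: hilbert_fun_def card_single_image)
qed

lemma card_Std_exact:
  fixes J :: "('n::finite, 'k::field) mpoly set"
  assumes J: "is_ideal J" and fin: "finite (Std J)"
  shows "card (Std J) = card (Std (colon J f)) + card (Std (ideal_gen (insert f J)))"
proof -
  have "finite (Std (colon J f))"
    using finite_subset[OF Std_antimono[OF colon_superset[OF J]] fin] .
  moreover have "finite (Std (ideal_gen (insert f J)))"
    using ideal_gen_superset[of "insert f J"] by (intro finite_subset[OF Std_antimono fin]) auto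
  ultimately have "quot_dim UNIV J = card ((\<lambda>m. single m (1::'k)) ` Std (colon J f)) +
    card ((\<lambda>m. single m (1::'k)) ` Std (ideal_gen (insert f J)))"
    by (intro quot_dim_exact[where f = f, OF _ _ _ quot_basis_UNIV quot_basis_UNIV])
      (auto simp: J is_ideal_colon is_ideal_ideal_gen mem_ideal_gen_insert mem_colon kscale_subspace_def
        subspace_ideal intro: ideal_0 ideal_add kscale_in_ideal)
  then show ?thesis by (simp add: quot_dim_Std[OF J fin] card_single_image)
qed

section \<open>Multiplicities\<close>

definition cone :: "('n \<Rightarrow>\<^sub>0 nat) \<Rightarrow> 'n set \<Rightarrow> ('n \<Rightarrow>\<^sub>0 nat) set"
  where "cone a T = {m. \<forall>i. (i \<in> T \<longrightarrow> lookup a i \<le> lookup m i) \<and> (i \<notin> T \<longrightarrow> lookup m i = lookup a i)}"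

lemma cone_eq_image: "cone a T = (+) a ` {u. keys u \<subseteq> T}"
proof
  show "cone a T \<subseteq> (+) a ` {u. keys u \<subseteq> T}"
  proof
    fix m assume m: "m \<in> cone a T"
    then have le: "lookup a i \<le> lookup m i" for i by (cases "i \<in> T") (auto simp: cone_def)
    have "m = a + (m - a)"
      using le by (intro poly_mapping_eqI) (simp add: lookup_add lookup_minus)
    moreover have "lookup (m - a) i = 0" if "i \<notin> T" for i
      using m that by (simp add: cone_def lookup_minus)
    then have "keys (m - a) \<subseteq> T" by (meson in_keys_iff subsetI)
    ultimately show "m \<in> (+) a ` {u. keys u \<subseteq> T}" by blast
  qed
qed (auto simp: cone_def lookup_add in_keys_iff)

lemma apex_in_cone: "a \<in> cone a T"
  by (simp add: cone_def)

text \<open>The slices of D at exponent i in direction x shrink as i grows. If they never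
  stabilized, each N would admit a monomial m N lying in slice N but not in a later slice i N;
  Dickson's lemma applied to these monomials gives a contradiction.\<close>

lemma slices_stabilize:
  fixes D :: "('n::finite \<Rightarrow>\<^sub>0 nat) set"
  assumes down: "\<And>a b. b \<in> D \<Longrightarrow> mon_dvd a b \<Longrightarrow> a \<in> D"
  shows "\<exists>N. \<forall>i\<ge>N. \<forall>m. m + single x i \<in> D \<longleftrightarrow> m + single x N \<in> D"
proof (rule ccontr)
  have mono: "m + single x i \<in> D" if "m + single x j \<in> D" "i \<le> j" for m i j
    using down[OF that(1)] that(2) by (auto simp: mon_dvd_def lookup_add lookup_single when_def)
  assume *: "\<not> ?thesis"
  have "\<forall>N. \<exists>i m. N < i \<and> m + single x N \<in> D \<and> m + single x i \<notin> D"
  proof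
    fix N
    from * obtain i m where im: "i \<ge> N" "(m + single x i \<in> D) \<noteq> (m + single x N \<in> D)" by blast
    then have "m + single x N \<in> D" "m + single x i \<notin> D" using mono[of m i N] by auto
    then show "\<exists>i m. N < i \<and> m + single x N \<in> D \<and> m + single x i \<notin> D"
      using im(1) by (intro exI[of _ i] exI[of _ m]) (auto simp: order.strict_iff_order)
  qed
  then obtain i m where im: "\<And>N. N < i N" "\<And>N. m N + single x N \<in> D" "\<And>N. m N + single x (i N) \<notin> D"
    by metis
  obtain r :: "nat \<Rightarrow> nat" where r: "strict_mono r" "\<forall>k l. k \<le> l \<longrightarrow> mon_dvd (m (r k)) (m (r l))"
    using dickson[of m] by blast
  \<comment> \<open>At level l the monomial m (r 0) has left D. Since l <= r l, m (r l) is still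
    present at level l, and it is a multiple of m (r 0).\<close>
  define l where "l = i (r 0)"
  have "l \<le> r l" using r(1) by (rule seq_suble)
  then have "m (r l) + single x l \<in> D" using im(2)[of "r l"] by (rule mono[rotated])
  moreover have "mon_dvd (m (r 0) + single x l) (m (r l) + single x l)"
    using r(2) by (auto simp: mon_dvd_def lookup_add)
  ultimately show False using im(3)[of "r 0"] down by (auto simp: l_def)
qed

text \<open>Induction on the variables that occur. Each of the finitely many slices below the stable
  level N contributes its cones, shifted to its exponent of x. The slice at N stands for all higher
  ones, so there x becomes an additional direction of the cones.\<close>

lemma cone_decomposition:
  fixes D :: "('n::finite \<Rightarrow>\<^sub>0 nat) set"
  assumes "finite X" "\<And>m. m \<in> D \<Longrightarrow> keys m \<subseteq> X" "\<And>a b. b \<in> D \<Longrightarrow> mon_dvd a b \<Longrightarrow> a \<in> D"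
  shows "\<exists>C. finite C \<and> D = (\<Union>(a, T)\<in>C. cone a T) \<and>
    (\<forall>p\<in>C. \<forall>q\<in>C. p \<noteq> q \<longrightarrow> cone (fst p) (snd p) \<inter> cone (fst q) (snd q) = {})"
  using assms
proof (induction X arbitrary: D)
  case empty
  then have "m = 0" if "m \<in> D" for m
    using that by (intro poly_mapping_eqI) (auto simp: in_keys_iff subset_iff)
  then consider "D = {}" | "D = {0}" by blast
  then show ?case
  proof cases
    case 1
    then show ?thesis by (intro exI[of _ "{}"]) auto
  next
    case 2
    have "cone 0 {} = {0 :: 'n \<Rightarrow>\<^sub>0 nat}" by (auto simp: cone_def intro!: poly_mapping_eqI)
    then show ?thesis using 2 by (intro exI[of _ "{(0, {})}"]) auto
  qed
next
  case (insert x X D)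
  obtain N where N: "\<And>i m. N \<le> i \<Longrightarrow> m + single x i \<in> D \<longleftrightarrow> m + single x N \<in> D"
    using slices_stabilize[of D x] insert.prems(2) by blast
  define E where "E i = {m. keys m \<subseteq> X \<and> m + single x i \<in> D}" for i
  have "\<exists>C. finite C \<and> E i = (\<Union>(a, T)\<in>C. cone a T) \<and>
    (\<forall>p\<in>C. \<forall>q\<in>C. p \<noteq> q \<longrightarrow> cone (fst p) (snd p) \<inter> cone (fst q) (snd q) = {})" for i
  proof (rule insert.IH)
    fix a b assume "b \<in> E i" "mon_dvd a b"
    moreover have "mon_dvd (a + single x i) (b + single x i)"
      using \<open>mon_dvd a b\<close> by (simp add: mon_dvd_def lookup_add)
    moreover have "keys a \<subseteq> keys b"
      using \<open>mon_dvd a b\<close> by (auto simp: mon_dvd_def in_keys_iff) (metis le_zero_eq neq0_conv)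
    ultimately show "a \<in> E i" using insert.prems(2) by (auto simp: E_def)
  qed (auto simp: E_def)
  then obtain C where C: "\<And>i. finite (C i)" "\<And>i. E i = (\<Union>(a, T)\<in>C i. cone a T)"
    "\<And>i p q. p \<in> C i \<Longrightarrow> q \<in> C i \<Longrightarrow> p \<noteq> q \<Longrightarrow> cone (fst p) (snd p) \<inter> cone (fst q) (snd q) = {}"
    by metis
  \<comment> \<open>The slices avoid x, so none of their cones involves x in its apex or its
    directions. This is what lets the exponent of x be separated from the rest of a
    monomial.\<close>
  have xa: "lookup a x = 0" "x \<notin> T" if "(a, T) \<in> C i" for a T i
  proof -
    have sub: "cone a T \<subseteq> E i" using that C(2)[of i] by blast
    then have "keys m \<subseteq> X" if "m \<in> cone a T" for m using that by (auto simp: E_def)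
    then have x0: "lookup m x = 0" if "m \<in> cone a T" for m
      using that \<open>x \<notin> X\<close> by (meson in_keys_iff subsetD)
    show "lookup a x = 0" by (rule x0[OF apex_in_cone])
    show "x \<notin> T"
    proof
      assume "x \<in> T"
      then have "a + single x 1 \<in> cone a T"
        by (auto simp: cone_def lookup_add lookup_single when_def)
      from x0[OF this] show False by (simp add: lookup_add)
    qed
  qed
  define F where "F i = (\<lambda>(a, T). (a + single x i, if i < N then T else insert x T)) ` C i" for i
  define rest where "rest m = m - single x (lookup m x)" for m :: "'n \<Rightarrow>\<^sub>0 nat"
  have rest: "lookup (rest m) j = (if j = x then 0 else lookup m j)" for m j
    by (simp add: rest_def lookup_minus lookup_single when_def)
  have rest_add: "rest m + single x (lookup m x) = m" for m
    by (rule poly_mapping_eqI) (simp add: lookup_add rest lookup_single when_def)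
  have F_cone: "m \<in> cone (a + single x i) (if i < N then T else insert x T) \<longleftrightarrow>
      (if i < N then lookup m x = i else i \<le> lookup m x) \<and> rest m \<in> cone a T"
    if "(a, T) \<in> C i" for m a T i
    using xa[OF that] by (auto simp: cone_def lookup_add rest lookup_single when_def split: if_splits)
  \<comment> \<open>All slices from N on coincide, so the slice that decides about m is its exponent
    of x, capped at N.\<close>
  have D_iff: "m \<in> D \<longleftrightarrow> rest m \<in> E (min N (lookup m x))" for m
  proof -
    have "rest m + single x (min N (lookup m x)) \<in> D \<longleftrightarrow> m \<in> D"
      using N[of "lookup m x" "rest m"] rest_add[of m] by (auto simp: min_def)
    moreover have "keys (rest m) \<subseteq> X" if "m \<in> D"
      using insert.prems(1)[OF that] by (auto simp: in_keys_iff rest subset_iff)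
    ultimately show ?thesis by (auto simp: E_def)
  qed
  let ?C = "\<Union>i\<le>N. F i"
  have mem: "m \<in> cone (fst p) (snd p) \<longleftrightarrow> min N (lookup m x) = i \<and> rest m \<in> cone a T"
    if "i \<le> N" "(a, T) \<in> C i" "p = (a + single x i, if i < N then T else insert x T)" for m p a T i
    using F_cone[OF that(2), of m] that(1,3) by auto
  show ?case
  proof (intro exI[of _ ?C] conjI)
    show "finite ?C" using C(1) by (auto simp: F_def)
    show "D = (\<Union>(a, T)\<in>?C. cone a T)"
    proof (intro set_eqI iffI)
      fix m assume "m \<in> D"
      define i where "i = min N (lookup m x)"
      have "rest m \<in> E i" using \<open>m \<in> D\<close> D_iff by (simp add: i_def)
      then obtain a T where aT: "(a, T) \<in> C i" "rest m \<in> cone a T" using C(2) by auto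
      let ?p = "(a + single x i, if i < N then T else insert x T)"
      have "i \<le> N" by (simp add: i_def)
      moreover have "?p \<in> F i" using aT(1) by (force simp: F_def)
      moreover have "m \<in> cone (fst ?p) (snd ?p)"
        using mem[OF \<open>i \<le> N\<close> aT(1) refl] aT(2) by (simp add: i_def)
      ultimately show "m \<in> (\<Union>(a, T)\<in>?C. cone a T)" by (force simp: case_prod_unfold)
    next
      fix m assume "m \<in> (\<Union>(a, T)\<in>?C. cone a T)"
      then obtain p i where p: "i \<le> N" "p \<in> F i" "m \<in> cone (fst p) (snd p)" by auto
      then obtain a T where aT: "(a, T) \<in> C i" "p = (a + single x i, if i < N then T else insert x T)"
        by (auto simp: F_def)
      then have "min N (lookup m x) = i" "rest m \<in> cone a T" using mem[OF p(1) aT] p(3) by auto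
      then show "m \<in> D" using aT(1) C(2)[of i] D_iff by auto
    qed
    show "\<forall>p\<in>?C. \<forall>q\<in>?C. p \<noteq> q \<longrightarrow> cone (fst p) (snd p) \<inter> cone (fst q) (snd q) = {}"
    proof (intro ballI impI, rule ccontr)
      fix p q assume "p \<in> ?C" "q \<in> ?C" and pq: "p \<noteq> q" "cone (fst p) (snd p) \<inter> cone (fst q) (snd q) \<noteq> {}"
      then obtain m where m: "m \<in> cone (fst p) (snd p)" "m \<in> cone (fst q) (snd q)" by blast
      obtain i a T where p: "i \<le> N" "(a, T) \<in> C i" "p = (a + single x i, if i < N then T else insert x T)"
        using \<open>p \<in> ?C\<close> by (auto simp: F_def)
      obtain j b U where q: "j \<le> N" "(b, U) \<in> C j" "q = (b + single x j, if j < N then U else insert x U)"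
        using \<open>q \<in> ?C\<close> by (auto simp: F_def)
      have ij: "i = j" and "rest m \<in> cone a T" "rest m \<in> cone b U"
        using m mem[OF p] mem[OF q] by auto
      then have "(a, T) = (b, U)" using C(3)[OF p(2), of "(b, U)"] q(2) by auto
      then have "p = q" using p(3) q(3) ij by simp
      then show False using pq(1) by simp
    qed
  qed
qed

text \<open>Stars and bars. With truncated subtraction the formula also covers T = {}: it gives 1
  for e = 0 and (e - 1 choose e) = 0 otherwise.\<close>

lemma card_mon_deg_keys:
  fixes T :: "'n::finite set"
  shows "card {u. keys u \<subseteq> T \<and> mon_deg u = e} = (e + card T - 1) choose e"
proof -
  have "finite T" by simp
  then show ?thesis
  proof (induction T arbitrary: e)
    case empty
    have "{u :: 'n \<Rightarrow>\<^sub>0 nat. keys u \<subseteq> {} \<and> mon_deg u = e} = (if e = 0 then {0} else {})"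
      by (auto simp: mon_deg_eq_0_iff)
    then show ?case by (cases e) (auto simp: binomial_eq_0)
  next
    case (insert x T)
    let ?A = "\<lambda>e. {u. keys u \<subseteq> T \<and> mon_deg u = e}"
    let ?B = "{u. keys u \<subseteq> insert x T \<and> mon_deg u = e}"
    have fin: "finite (?A e)" for e by (rule finite_subset[OF _ finite_mon_deg[of e]]) auto
    have look: "lookup u x = 0" if "keys u \<subseteq> T" for u :: "'n \<Rightarrow>\<^sub>0 nat"
      using that insert.hyps(2) by (meson in_keys_iff subsetD)
    \<comment> \<open>Here i is the degree left to the variables in T, and e - i is the exponent of
      the new variable x.\<close>
    have "bij_betw (\<lambda>(i, u). u + single x (e - i)) (SIGMA i:{..e}. ?A i) ?B"
    proof (rule bij_betw_imageI)
      show "inj_on (\<lambda>(i, u). u + single x (e - i)) (SIGMA i:{..e}. ?A i)"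
      proof (rule inj_onI)
        fix p q assume p: "p \<in> (SIGMA i:{..e}. ?A i)" and q: "q \<in> (SIGMA i:{..e}. ?A i)"
          and "(\<lambda>(i, u). u + single x (e - i)) p = (\<lambda>(i, u). u + single x (e - i)) q"
        then have eq: "snd p + single x (e - fst p) = snd q + single x (e - fst q)"
          by (simp add: case_prod_unfold)
        have "lookup (snd p) x = 0" "lookup (snd q) x = 0" using p q look by auto
        with arg_cong[OF eq, of "\<lambda>w. lookup w x"] have "e - fst p = e - fst q"
          by (simp add: lookup_add)
        then show "p = q" using eq p q by (auto simp: prod_eq_iff)
      qed
      show "(\<lambda>(i, u). u + single x (e - i)) ` (SIGMA i:{..e}. ?A i) = ?B"
      proof (intro equalityI subsetI)
        fix w assume "w \<in> (\<lambda>(i, u). u + single x (e - i)) ` (SIGMA i:{..e}. ?A i)"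
        then show "w \<in> ?B" by (auto simp: mon_deg_add mon_keys_add split: if_splits)
      next
        fix w assume w: "w \<in> ?B"
        define u where "u = w - single x (lookup w x)"
        have wu: "w = u + single x (lookup w x)"
          by (rule poly_mapping_eqI) (simp add: u_def lookup_add lookup_minus lookup_single when_def)
        have "mon_deg w = mon_deg u + lookup w x" by (subst wu) (simp add: mon_deg_add)
        moreover have "keys u \<subseteq> T" using w
          by (auto simp: in_keys_iff u_def lookup_minus lookup_single when_def subset_iff split: if_splits)
        ultimately have mem: "(mon_deg u, u) \<in> (SIGMA i:{..e}. ?A i)" and lx: "lookup w x = e - mon_deg u"
          using w by auto
        show "w \<in> (\<lambda>(i, u). u + single x (e - i)) ` (SIGMA i:{..e}. ?A i)"
        proof (rule image_eqI)
          show "w = (case (mon_deg u, u) of (i, u) \<Rightarrow> u + single x (e - i))"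
            using wu unfolding lx prod.case .
        qed (rule mem)
      qed
    qed
    then have "card ?B = card (SIGMA i:{..e}. ?A i)"
      by (intro bij_betw_same_card[symmetric])
    also have "\<dots> = (\<Sum>i\<le>e. (i + card T - 1) choose i)"
      using fin by (simp add: insert.IH)
    \<comment> \<open>The hockey-stick identity. If T is empty, only the summand i = 0
      survives.\<close>
    also have "\<dots> = (e + card T) choose e"
    proof (cases "card T")
      case 0
      have "(\<Sum>i\<le>e. (i + card T - 1) choose i) = (\<Sum>i\<le>e. if i = 0 then 1 else 0)"
        by (rule sum.cong) (auto simp: 0 binomial_eq_0)
      then show ?thesis by (simp add: 0)
    next
      case (Suc t)
      then show ?thesis using sum_choose_lower[of t e] by (simp add: add.commute)
    qed
    finally show ?case using insert.hyps by simp
  qed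
qed

lemma card_cone_deg:
  fixes T :: "'n::finite set"
  shows "card {m \<in> cone a T. mon_deg m = mon_deg a + e} = (e + card T - 1) choose e"
proof -
  have "{m \<in> cone a T. mon_deg m = mon_deg a + e} = (+) a ` {u. keys u \<subseteq> T \<and> mon_deg u = e}"
    by (auto simp: cone_eq_image mon_deg_add)
  then show ?thesis by (simp add: card_image card_mon_deg_keys)
qed

section \<open>Growth of the number of monomials of a cone\<close>

lemma tendsto_shifted_ratio: "(\<lambda>d. (real d + c) / real d) \<longlonglongrightarrow> 1"
proof -
  have "(\<lambda>d. 1 + c / real d) \<longlonglongrightarrow> 1 + 0"
    by (intro tendsto_intros lim_const_over_n)
  moreover have "\<forall>\<^sub>F d in sequentially. 1 + c / real d = (real d + c) / real d"
    using eventually_gt_at_top[of 0] by eventually_elim (simp add: field_simps)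
  ultimately have "(\<lambda>d. (real d + c) / real d) \<longlonglongrightarrow> 1 + 0" by (rule Lim_transform_eventually)
  then show ?thesis by simp
qed

text \<open>From degree \<open>mon_deg a\<close> on, the count is (d - \<open>mon_deg a\<close> + r
  choose r): a product of r factors, each asymptotic to d, divided by r!.\<close>

lemma cone_asymptotics_full:
  fixes T :: "'n::finite set"
  assumes T: "card T = Suc r"
  shows "(\<lambda>d. fact r * real (card {m \<in> cone a T. mon_deg m = d}) / real d ^ r) \<longlonglongrightarrow> 1"
proof -
  have "(\<lambda>d. \<Prod>i=0..<r. (real d + (real r - real (mon_deg a) - real i)) / real d) \<longlonglongrightarrow> (\<Prod>i=0..<r. 1)"
    by (intro tendsto_prod tendsto_shifted_ratio)
  moreover have "\<forall>\<^sub>F d in sequentially. (\<Prod>i=0..<r. (real d + (real r - real (mon_deg a) - real i)) / real d)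
     = fact r * real (card {m \<in> cone a T. mon_deg m = d}) / real d ^ r"
    using eventually_ge_at_top[of "mon_deg a"]
  proof eventually_elim
    case (elim d)
    define e where "e = d - mon_deg a"
    have d: "d = mon_deg a + e" using elim by (simp add: e_def)
    have "card {m \<in> cone a T. mon_deg m = d} = (e + r) choose e"
      by (simp add: d card_cone_deg T)
    also have "\<dots> = (e + r) choose r" by (subst binomial_symmetric) auto
    finally have "real (card {m \<in> cone a T. mon_deg m = d}) = (\<Prod>i=0..<r. real (e + r) - real i) / fact r"
      by (simp add: binomial_gbinomial gbinomial_prod_rev)
    then have "fact r * real (card {m \<in> cone a T. mon_deg m = d}) / real d ^ r
        = (\<Prod>i=0..<r. (real (e + r) - real i) / real d)"
      by (simp add: prod_dividef)
    also have "\<dots> = (\<Prod>i=0..<r. (real d + (real r - real (mon_deg a) - real i)) / real d)"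
      by (rule prod.cong) (auto simp: d algebra_simps)
    finally show ?case ..
  qed
  ultimately have "(\<lambda>d. fact r * real (card {m \<in> cone a T. mon_deg m = d}) / real d ^ r)
      \<longlonglongrightarrow> (\<Prod>i=0..<r. 1)"
    by (rule Lim_transform_eventually)
  then show ?thesis by simp
qed

lemma cone_asymptotics:
  fixes T :: "'n::finite set"
  assumes "card T \<le> Suc r"
  shows "(\<lambda>d. fact r * real (card {m \<in> cone a T. mon_deg m = d}) / real d ^ r)
    \<longlonglongrightarrow> (if card T = Suc r then 1 else 0)"
proof (cases "card T")
  case 0
  have "\<forall>\<^sub>F d in sequentially. 0 = fact r * real (card {m \<in> cone a T. mon_deg m = d}) / real d ^ r"
    using eventually_gt_at_top[of "mon_deg a"]
  proof eventually_elim
    case (elim d)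
    then have "d = mon_deg a + (d - mon_deg a)" by simp
    then have "card {m \<in> cone a T. mon_deg m = d} = (d - mon_deg a + card T - 1) choose (d - mon_deg a)"
      by (metis card_cone_deg)
    then show ?case using 0 elim by (simp add: binomial_eq_0)
  qed
  then have "(\<lambda>d. fact r * real (card {m \<in> cone a T. mon_deg m = d}) / real d ^ r) \<longlonglongrightarrow> 0"
    by (rule tendsto_eventually[OF eventually_mono]) simp
  then show ?thesis using 0 by simp
next
  case (Suc q)
  show ?thesis
  proof (cases "q = r")
    case True
    then show ?thesis using Suc cone_asymptotics_full by auto
  next
    case False
    then have "q < r" using assms Suc by simp
    let ?c = "\<lambda>d. real (card {m \<in> cone a T. mon_deg m = d})"
    \<comment> \<open>Under its own normalization d^q the count has limit 1, and the remaining
      factor, a constant over d^(r - q), tends to 0.\<close>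
    have "(\<lambda>d. (fact q * ?c d / real d ^ q) * (fact r / fact q * (1 / real d) ^ (r - q)))
        \<longlonglongrightarrow> 1 * (fact r / fact q * 0 ^ (r - q))"
      by (intro tendsto_intros cone_asymptotics_full Suc lim_const_over_n)
    moreover have "\<forall>\<^sub>F d in sequentially. (fact q * ?c d / real d ^ q) * (fact r / fact q * (1 / real d) ^ (r - q))
        = fact r * ?c d / real d ^ r"
      using eventually_gt_at_top[of 0]
    proof eventually_elim
      case (elim d)
      have "real d ^ r = real d ^ q * real d ^ (r - q)"
        using \<open>q < r\<close> by (simp flip: power_add)
      then show ?case using elim by (simp add: power_divide)
    qed
    ultimately have "(\<lambda>d. fact r * ?c d / real d ^ r) \<longlonglongrightarrow> 1 * (fact r / fact q * 0 ^ (r - q))"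
      by (rule Lim_transform_eventually)
    then have "(\<lambda>d. fact r * ?c d / real d ^ r) \<longlonglongrightarrow> 0"
      using \<open>q < r\<close> by (simp add: zero_power)
    then show ?thesis using False Suc by simp
  qed
qed

text \<open>The multiplicity of \<open>S/J\<close> in dimension \<open>t\<close>: it is \<open>0\<close> if \<open>S/J\<close> has a smaller dimension.\<close>

definition has_mult :: "nat \<Rightarrow> ('n::finite, 'k::field) mpoly set \<Rightarrow> nat \<Rightarrow> bool"
  where "has_mult t J n \<longleftrightarrow> (if t = 0 then finite (Std J) \<and> card (Std J) = n
    else (\<lambda>d. fact (t - 1) * real (card (Std_deg J d)) / real d ^ (t - 1)) \<longlonglongrightarrow> real n)"

text \<open>The number n is a natural number because it counts the t-dimensional cones in a
  decomposition of \<open>Std J\<close>; smaller cones vanish in the limit. For t = 0 the cones are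
  points and \<open>Std J\<close> is finite.\<close>

lemma ex_has_mult:
  fixes J :: "('n::finite, 'k::field) mpoly set"
  assumes J: "is_ideal J" and bound: "\<And>a T. cone a T \<subseteq> Std J \<Longrightarrow> card T \<le> t"
  shows "\<exists>n. has_mult t J n"
proof -
  have "\<exists>C. finite C \<and> Std J = (\<Union>(a, T)\<in>C. cone a T) \<and>
    (\<forall>p\<in>C. \<forall>q\<in>C. p \<noteq> q \<longrightarrow> cone (fst p) (snd p) \<inter> cone (fst q) (snd q) = {})"
    by (rule cone_decomposition[of UNIV]) (auto intro: Std_mon_dvd[OF J])
  then obtain C where C: "finite C" "Std J = (\<Union>(a, T)\<in>C. cone a T)"
    "\<forall>p\<in>C. \<forall>q\<in>C. p \<noteq> q \<longrightarrow> cone (fst p) (snd p) \<inter> cone (fst q) (snd q) = {}"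
    by blast
  have le: "card T \<le> t" if "(a, T) \<in> C" for a T
    using that C(2) by (intro bound[of a T]) auto
  show ?thesis
  proof (cases t)
    case 0
    have "cone a T = {a}" if "(a, T) \<in> C" for a T
      using le[OF that] 0 by (auto simp: cone_def intro!: poly_mapping_eqI)
    then have "finite (Std J)" unfolding C(2) using C(1) by auto
    then show ?thesis by (simp add: has_mult_def 0)
  next
    case (Suc r)
    have split: "card (Std_deg J d) = (\<Sum>p\<in>C. card {m \<in> cone (fst p) (snd p). mon_deg m = d})" for d
    proof -
      have "Std_deg J d = (\<Union>p\<in>C. {m \<in> cone (fst p) (snd p). mon_deg m = d})"
        unfolding C(2) by auto
      moreover have "finite {m \<in> cone (fst p) (snd p). mon_deg m = d}" for p :: "('n \<Rightarrow>\<^sub>0 nat) \<times> 'n set"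
        by (rule finite_subset[OF _ finite_mon_deg[of d]]) auto
      ultimately show ?thesis using C(1,3)
        by (simp only:) (rule card_UN_disjoint; blast)
    qed
    have "(\<lambda>d. \<Sum>p\<in>C. fact r * real (card {m \<in> cone (fst p) (snd p). mon_deg m = d}) / real d ^ r)
        \<longlonglongrightarrow> (\<Sum>p\<in>C. if card (snd p) = Suc r then 1 else 0)"
      using le Suc by (intro tendsto_sum cone_asymptotics) auto
    then have "(\<lambda>d. fact r * real (card (Std_deg J d)) / real d ^ r)
        \<longlonglongrightarrow> real (\<Sum>p\<in>C. if card (snd p) = Suc r then 1 else 0)"
      unfolding split by (simp add: sum_distrib_left sum_divide_distrib if_distrib[of real] cong: if_cong)
    then have "has_mult t J (\<Sum>p\<in>C. if card (snd p) = Suc r then 1 else 0)"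
      by (simp add: has_mult_def Suc del: of_nat_sum)
    then show ?thesis by blast
  qed
qed

lemma has_mult_unique: "has_mult t J n \<Longrightarrow> has_mult t J n' \<Longrightarrow> n = n'"
  by (auto simp: has_mult_def dest: LIMSEQ_unique split: if_splits)

lemma has_mult_antimono:
  assumes "J \<subseteq> J'" "has_mult t J n" "has_mult t J' n'"
  shows "n' \<le> n"
proof (cases "t = 0")
  case True
  then show ?thesis using assms Std_antimono[OF assms(1)] by (auto simp: has_mult_def intro: card_mono)
next
  case False
  have "card (Std_deg J' d) \<le> card (Std_deg J d)" for d
    using Std_antimono[OF assms(1)] by (intro card_mono finite_Std_deg) auto
  then have "fact (t - 1) * real (card (Std_deg J' d)) / real d ^ (t - 1)
      \<le> fact (t - 1) * real (card (Std_deg J d)) / real d ^ (t - 1)" for d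
    by (intro divide_right_mono mult_left_mono) auto
  then have "real n' \<le> real n"
    using assms(2,3) False by (intro LIMSEQ_le) (auto simp: has_mult_def)
  then show ?thesis by simp
qed

lemma has_mult_exact:
  fixes J :: "('n::finite, 'k::field) mpoly set"
  assumes J: "graded_ideal J" and f: "f \<in> forms e"
    and n: "has_mult t J n" and n': "has_mult t (colon J f) n'"
  shows "has_mult t (ideal_gen (insert f J)) (n - n')"
proof (cases t)
  case 0
  then have fin: "finite (Std J)" using n by (simp add: has_mult_def)
  moreover have "finite (Std (ideal_gen (insert f J)))"
    using ideal_gen_superset[of "insert f J"] by (intro finite_subset[OF Std_antimono fin]) auto
  ultimately show ?thesis
    using n n' card_Std_exact[OF graded_imp_ideal[OF J] fin, of f] by (simp add: has_mult_def 0)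
next
  case (Suc r)
  let ?h = "\<lambda>J d. real (card (Std_deg (J :: ('n, 'k) mpoly set) d))"
  have lim: "(\<lambda>d. fact r * ?h J d / real d ^ r) \<longlonglongrightarrow> real n"
    "(\<lambda>d. fact r * ?h (colon J f) d / real d ^ r) \<longlonglongrightarrow> real n'"
    using n n' by (auto simp: has_mult_def Suc)
  \<comment> \<open>Multiplication by f shifts degrees by e. Dividing by ((d + e)/d)^r, which tends
    to 1, changes the normalization from d^r to (d + e)^r.\<close>
  have "(\<lambda>d. fact r * ?h (colon J f) d / real d ^ r / ((real d + e) / real d) ^ r) \<longlonglongrightarrow> real n' / 1 ^ r"
    by (intro tendsto_intros lim tendsto_shifted_ratio) auto
  moreover have "\<forall>\<^sub>F d in sequentially. fact r * ?h (colon J f) d / real d ^ r / ((real d + e) / real d) ^ r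
      = fact r * ?h (colon J f) d / real (d + e) ^ r"
    using eventually_gt_at_top[of 0] by eventually_elim (simp add: power_divide add_pos_nonneg)
  ultimately have "(\<lambda>d. fact r * ?h (colon J f) d / real (d + e) ^ r) \<longlonglongrightarrow> real n' / 1 ^ r"
    by (rule Lim_transform_eventually)
  then have "(\<lambda>d. fact r * ?h (colon J f) d / real (d + e) ^ r) \<longlonglongrightarrow> real n'"
    by simp
  from tendsto_diff[OF LIMSEQ_ignore_initial_segment[OF lim(1), of e] this]
  have "(\<lambda>d. fact r * ?h (ideal_gen (insert f J)) (d + e) / real (d + e) ^ r) \<longlonglongrightarrow> real n - real n'"
    by (simp add: hilbert_fun_exact[OF J f] diff_divide_distrib[symmetric] right_diff_distrib[symmetric])
  then have "(\<lambda>d. fact r * ?h (ideal_gen (insert f J)) d / real d ^ r) \<longlonglongrightarrow> real n - real n'"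
    by (rule LIMSEQ_offset)
  moreover have "n' \<le> n" using has_mult_antimono[OF colon_superset[OF graded_imp_ideal[OF J]] n n'] .
  ultimately show ?thesis by (simp add: has_mult_def Suc)
qed

text \<open>The normalization in \<open>has_mult\<close> agrees with that of
  \<open>degree_quot\<close> when t is the Krull dimension of S/J, which is why that dimension must
  be computed.\<close>

lemma degree_quot_eq:
  fixes J :: "('n::finite, 'k::field) mpoly set"
  assumes J: "graded_ideal J" and "krull_dim_quot J = enat t" and n: "has_mult t J n"
  shows "degree_quot J = real n"
proof (cases t)
  case 0
  then show ?thesis
    using assms quot_dim_Std[OF graded_imp_ideal[OF J]] by (simp add: degree_quot_def has_mult_def)
next
  case (Suc r)
  have "(\<lambda>d. fact r * real (card (Std_deg J d)) / real d ^ r / fact r) \<longlonglongrightarrow> real n / fact r"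
    using n by (intro tendsto_divide tendsto_const) (auto simp: has_mult_def Suc)
  then have "(\<lambda>d. real (hilbert_fun J d) / real d ^ r) \<longlonglongrightarrow> real n / fact r"
    by (simp add: hilbert_fun_Std[OF J])
  then have "lim (\<lambda>d. real (hilbert_fun J d) / real d ^ r) = real n / fact r" by (rule limI)
  then show ?thesis using assms(2) Suc by (simp add: degree_quot_def)
qed

section \<open>Ideals generated by linear forms\<close>

definition mon_subst :: "('n::finite \<Rightarrow> ('n, 'k::field) mpoly) \<Rightarrow> ('n \<Rightarrow>\<^sub>0 nat) \<Rightarrow> ('n, 'k) mpoly"
  where "mon_subst g m = (\<Prod>i\<in>UNIV. g i ^ lookup m i)"

definition poly_subst :: "('n::finite \<Rightarrow> ('n, 'k::field) mpoly) \<Rightarrow> ('n, 'k) mpoly \<Rightarrow> ('n, 'k) mpoly"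
  where "poly_subst g f = (\<Sum>m\<in>keys f. kscale (lookup f m) (mon_subst g m))"

lemma mon_subst_add: "mon_subst g (a + b) = mon_subst g a * mon_subst g b"
  by (simp add: mon_subst_def lookup_add power_add prod.distrib)

lemma mon_subst_0 [simp]: "mon_subst g 0 = 1"
  by (simp add: mon_subst_def)

lemma mon_subst_single1 [simp]: "mon_subst g (single i 1) = g i"
proof -
  have "mon_subst g (single i 1) = (\<Prod>j\<in>UNIV. if j = i then g i else 1)"
    unfolding mon_subst_def by (rule prod.cong) (auto simp: lookup_single when_def)
  then show ?thesis by simp
qed

lemma kscale_simps [simp]: "kscale 0 f = 0" "kscale 1 f = f" "kscale c 0 = 0"
  by (simp_all add: kscale_def)

lemma kscale_add_left: "kscale (a + b) f = kscale a f + kscale b f"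
  by (simp add: kscale_def single_add distrib_right)

lemma kscale_mult: "kscale a f * kscale b g = kscale (a * b) (f * g)"
proof -
  have "kscale a f * kscale b g = (single 0 a * single 0 b) * (f * g)"
    by (simp add: kscale_def ac_simps)
  then show ?thesis by (simp add: kscale_def mult_single)
qed

lemma poly_subst_superset:
  assumes "finite A" "keys f \<subseteq> A"
  shows "poly_subst g f = (\<Sum>m\<in>A. kscale (lookup f m) (mon_subst g m))"
  unfolding poly_subst_def using assms by (intro sum.mono_neutral_left) (auto simp: in_keys_iff)

lemma poly_subst_add: "poly_subst g (f + h) = poly_subst g f + poly_subst g h"
  using keys_add[of f h]
  by (simp add: poly_subst_superset[of "keys f \<union> keys h"] lookup_add kscale_add_left sum.distrib)

lemma poly_subst_0 [simp]: "poly_subst g 0 = 0"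
  by (simp add: poly_subst_def)

lemma poly_subst_sum: "poly_subst g (sum h A) = (\<Sum>x\<in>A. poly_subst g (h x))"
  by (induction A rule: infinite_finite_induct) (simp_all add: poly_subst_add)

lemma poly_subst_single: "poly_subst g (single m c) = kscale c (mon_subst g m)"
  by (simp add: poly_subst_superset[of "{m}"])

lemma poly_subst_1 [simp]: "poly_subst g 1 = 1"
  using poly_subst_single[of g 0 1] by simp

lemma poly_subst_mult: "poly_subst g (f * h) = poly_subst g f * poly_subst g h"
proof -
  have "f * h = (\<Sum>a\<in>keys f. \<Sum>b\<in>keys h. single (a + b) (lookup f a * lookup h b))"
    by (subst (1) poly_sum_single[of f], subst (1) poly_sum_single[of h])
      (simp add: sum_product mult_single)
  then have "poly_subst g (f * h) = (\<Sum>a\<in>keys f. \<Sum>b\<in>keys h.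
      kscale (lookup f a) (mon_subst g a) * kscale (lookup h b) (mon_subst g b))"
    by (simp only: poly_subst_sum poly_subst_single mon_subst_add kscale_mult)
  then show ?thesis
    unfolding poly_subst_def[of g f] poly_subst_def[of g h] by (simp add: sum_product)
qed

lemma mon_subst_cong_mod:
  assumes P: "is_ideal P" and "\<And>i. g i - h i \<in> P"
  shows "mon_subst g m - mon_subst h m \<in> P"
proof -
  have mult: "a * b - a' * b' \<in> P" if "a - a' \<in> P" "b - b' \<in> P" for a b a' b'
  proof -
    have "a * b - a' * b' = b * (a - a') + a' * (b - b')" by (simp add: algebra_simps)
    then show ?thesis using that by (simp add: ideal_add ideal_mult P)
  qed
  have pow: "g i ^ k - h i ^ k \<in> P" for i k
    by (induction k) (auto intro: mult assms(2) ideal_0[OF P])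
  have "(\<Prod>i\<in>A. g i ^ lookup m i) - (\<Prod>i\<in>A. h i ^ lookup m i) \<in> P" if "finite A" for A
    using that by (induction A) (auto intro: mult pow ideal_0[OF P])
  then show ?thesis by (simp add: mon_subst_def)
qed

lemma mon_subst_tvar: "mon_subst tvar m = (single m 1 :: ('n::finite, 'k::field) mpoly)"
proof -
  have pow: "single (single i 1) 1 ^ k = (single (single i k) 1 :: ('n, 'k) mpoly)" for i k
    by (induction k) (simp_all add: mult_single flip: single_add)
  have "(\<Prod>i\<in>A. single (single i (lookup m i)) 1) = (single (\<Sum>i\<in>A. single i (lookup m i)) 1 :: ('n, 'k) mpoly)"
    if "finite A" for A using that by (induction A) (simp_all add: mult_single)
  moreover have "(\<Sum>i\<in>UNIV. single i (lookup m i)) = m"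
    by (rule poly_mapping_eqI) (simp add: lookup_sum lookup_single when_def)
  ultimately show ?thesis unfolding mon_subst_def tvar_def pow by simp
qed

lemma poly_subst_tvar: "poly_subst tvar f = f"
  by (subst (2) poly_sum_single) (simp add: poly_subst_def mon_subst_tvar kscale_single)

lemma kscale_diff_right: "kscale c (f - g) = kscale c f - kscale c g"
  by (simp add: kscale_def right_diff_distrib)

text \<open>\<open>poly_subst tvar\<close> is the identity, so the congruences for the variables
  only have to be carried through products and sums.\<close>

lemma poly_subst_cong_mod:
  assumes P: "is_ideal P" and "\<And>i. tvar i - g i \<in> P"
  shows "f - poly_subst g f \<in> P"
proof -
  have "poly_subst tvar f - poly_subst g f \<in> P"
    unfolding poly_subst_def sum_subtractf[symmetric] kscale_diff_right[symmetric]
    by (intro ideal_sum P kscale_in_ideal mon_subst_cong_mod assms)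
  then show ?thesis by (simp add: poly_subst_tvar)
qed

section \<open>The subring K[T] and the structure of linear primes\<close>

definition polys_in :: "'n set \<Rightarrow> ('n::finite, 'k::field) mpoly set"
  where "polys_in T = {f. \<forall>m\<in>keys f. keys m \<subseteq> T}"

lemma polys_in_0 [simp]: "0 \<in> polys_in T"
  by (simp add: polys_in_def)

lemma polys_in_1 [simp]: "1 \<in> polys_in T"
  by (simp add: polys_in_def)

lemma polys_in_add: "f \<in> polys_in T \<Longrightarrow> g \<in> polys_in T \<Longrightarrow> f + g \<in> polys_in T"
  using keys_add[of f g] by (auto simp: polys_in_def)

lemma polys_in_diff: "f \<in> polys_in T \<Longrightarrow> g \<in> polys_in T \<Longrightarrow> f - g \<in> polys_in T"
  using keys_diff_subset[of f g] by (auto simp: polys_in_def)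

lemma polys_in_sum: "(\<And>x. x \<in> A \<Longrightarrow> g x \<in> polys_in T) \<Longrightarrow> sum g A \<in> polys_in T"
  by (induction A rule: infinite_finite_induct) (auto intro: polys_in_add)

lemma polys_in_mult: "f \<in> polys_in T \<Longrightarrow> g \<in> polys_in T \<Longrightarrow> f * g \<in> polys_in T"
  using keys_mult[of f g] by (fastforce simp: polys_in_def mon_keys_add)

lemma poly_subst_id_on:
  assumes "\<And>i. i \<in> T \<Longrightarrow> g i = tvar i" "f \<in> polys_in T"
  shows "poly_subst g f = f"
proof -
  have "mon_subst g m = mon_subst tvar m" if "m \<in> keys f" for m
    unfolding mon_subst_def
  proof (rule prod.cong)
    fix i
    show "g i ^ lookup m i = tvar i ^ lookup m i"
    proof (cases "i \<in> T")
      case False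
      then have "i \<notin> keys m" using that assms(2) by (auto simp: polys_in_def)
      then have "lookup m i = 0" by (simp add: in_keys_iff)
      then show ?thesis by simp
    qed (simp add: assms(1))
  qed simp
  then have "poly_subst g f = poly_subst tvar f" by (simp add: poly_subst_def)
  then show ?thesis by (simp add: poly_subst_tvar)
qed

definition std_vars :: "('n::finite, 'k::field) mpoly set \<Rightarrow> 'n set"
  where "std_vars P = {i. single i 1 \<in> Std P}"

lemma tvar_in_forms: "tvar i \<in> forms 1"
  by (simp add: tvar_def single_in_forms)

text \<open>\<open>P\<close> is the kernel of the substitution of the normal forms of the variables,
  which is a retraction of \<open>S\<close> onto the polynomial ring in \<open>std_vars P\<close>.\<close>

lemma linear_retraction:
  fixes P :: "('n::finite, 'k::field) mpoly set"
  assumes "generated_by_linear_forms P"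
  obtains g where "P = {f. poly_subst g f = 0}" "\<And>i. i \<in> std_vars P \<Longrightarrow> g i = tvar i"
    "\<And>m. m \<in> Std P \<Longrightarrow> keys m \<subseteq> std_vars P"
proof -
  obtain L where L: "L \<subseteq> forms 1" "P = ideal_gen L"
    using assms by (auto simp: generated_by_linear_forms_def)
  have gr: "graded_ideal P" using L graded_linear by blast
  have P: "is_ideal P" using gr by (rule graded_imp_ideal)
  have "\<exists>w\<in>forms 1. keys w \<subseteq> Std P \<and> tvar i - w \<in> P" for i :: 'n
    by (rule normal_form_forms[OF gr tvar_in_forms])
  then obtain g where g: "\<And>i. g i \<in> forms 1" "\<And>i. keys (g i) \<subseteq> Std P" "\<And>i. tvar i - g i \<in> P"
    by metis
  have cong: "f - poly_subst g f \<in> P" for f by (rule poly_subst_cong_mod[OF P g(3)])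
  \<comment> \<open>For a linear form f the image is a K-linear combination of the g i, hence
    supported on standard monomials. It also lies in P, so it vanishes.\<close>
  have lin: "poly_subst g f = 0" if "f \<in> L" for f
  proof (rule Std_unique)
    have "f \<in> P" using that L(2) ideal_gen_superset by blast
    then show "poly_subst g f \<in> P" using ideal_diff_cancel[OF P cong] by blast
    have "keys (kscale (lookup f m) (mon_subst g m)) \<subseteq> Std P" if m: "m \<in> keys f" for m
    proof -
      have "mon_deg m = 1" using \<open>f \<in> L\<close> L(1) m by (auto simp: forms_def)
      then obtain i where "m = single i 1" by (rule mon_deg_1E)
      moreover have "lookup f m \<noteq> 0" using m by (simp add: in_keys_iff)
      ultimately show ?thesis using g(2)[of i] by (simp add: keys_kscale del: One_nat_def)
    qed
    then show "keys (poly_subst g f) \<subseteq> Std P"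
      unfolding poly_subst_def by (intro order.trans[OF keys_sum_subset]) auto
  qed
  have "P = {f. poly_subst g f = 0}"
  proof
    have "is_ideal {f. poly_subst g f = 0}"
      by (auto simp: is_ideal_iff poly_subst_add poly_subst_mult)
    then show "P \<subseteq> {f. poly_subst g f = 0}" unfolding L(2) using lin by (intro ideal_gen_minimal) auto
    show "{f. poly_subst g f = 0} \<subseteq> P"
    proof
      fix f assume "f \<in> {f. poly_subst g f = 0}"
      then show "f \<in> P" using cong[of f] by simp
    qed
  qed
  moreover have "g i = tvar i" if "i \<in> std_vars P" for i
  proof -
    have "keys (tvar i - g i) \<subseteq> Std P"
      using keys_diff_subset[of "tvar i" "g i"] g(2)[of i] that by (auto simp: tvar_def std_vars_def)
    from Std_unique[OF g(3) this] show ?thesis by simp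
  qed
  moreover have "keys m \<subseteq> std_vars P" if "m \<in> Std P" for m
  proof
    fix i assume "i \<in> keys m"
    then have "mon_dvd (single i 1) m" by (auto simp: mon_dvd_def lookup_single when_def in_keys_iff)
    then show "i \<in> std_vars P" using Std_mon_dvd[OF P that] by (simp add: std_vars_def)
  qed
  ultimately show ?thesis by (rule that)
qed

text \<open>P is the kernel of a ring endomorphism of a domain, and this endomorphism fixes
  1.\<close>

lemma linear_prime:
  fixes P :: "('n::finite, 'k::field) mpoly set"
  assumes "generated_by_linear_forms P"
  shows "prime_ideal P"
proof -
  obtain g where g: "P = {f. poly_subst g f = 0}" using linear_retraction[OF assms] by metis
  have "is_ideal P" unfolding g by (auto simp: is_ideal_iff poly_subst_add poly_subst_mult)
  moreover have "1 \<notin> P" by (simp add: g)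
  then have "P \<noteq> UNIV" by blast
  ultimately show ?thesis
    using mult_nonzero unfolding prime_ideal_def by (auto simp: g poly_subst_mult)
qed

lemma linear_graded: "generated_by_linear_forms P \<Longrightarrow> graded_ideal (P :: ('n::finite, 'k::field) mpoly set)"
  using graded_linear by (auto simp: generated_by_linear_forms_def)

lemma linear_ideal: "generated_by_linear_forms P \<Longrightarrow> is_ideal (P :: ('n::finite, 'k::field) mpoly set)"
  using linear_prime[of P] by (simp add: prime_ideal_def)

text \<open>A monomial in the standard variables differs from its normal form by an element of P
  that involves only these variables. The retraction fixes this element and kills P, so the monomial
  is its own normal form.\<close>

lemma linear_Std:
  fixes P :: "('n::finite, 'k::field) mpoly set"
  assumes lin: "generated_by_linear_forms P"
  shows "Std P = cone 0 (std_vars P)"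
proof -
  obtain g where g: "P = {f. poly_subst g f = 0}" "\<And>i. i \<in> std_vars P \<Longrightarrow> g i = tvar i"
    "\<And>m. m \<in> Std P \<Longrightarrow> keys m \<subseteq> std_vars P"
    using linear_retraction[OF assms] by metis
  have "m \<in> Std P" if m: "keys m \<subseteq> std_vars P" for m
  proof -
    obtain w where w: "keys w \<subseteq> Std P" "single m 1 - w \<in> P"
      using normal_form[OF linear_ideal[OF lin]] by blast
    have "single m 1 - w \<in> polys_in (std_vars P)"
      using w(1) g(3) m by (intro polys_in_diff) (auto simp: polys_in_def)
    then have "single m 1 - w = 0" using w(2) g(1) poly_subst_id_on[of "std_vars P" g] g(2) by auto
    then have "w = single m 1" by simp
    then have "keys w = {m}" by simp
    then show ?thesis using w(1) by simp
  qed
  then have "Std P = {m. keys m \<subseteq> std_vars P}" using g(3) by blast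
  then show ?thesis by (simp add: cone_eq_image)
qed

text \<open>For a linear prime this is the dimension of S/P, as \<open>krull_dim_quot_linear\<close>
  shows; counting standard variables makes it accessible before any chain of primes is
  considered.\<close>

definition linear_dim :: "('n::finite, 'k::field) mpoly set \<Rightarrow> nat"
  where "linear_dim P = card (std_vars P)"

lemma has_mult_linear:
  fixes P :: "('n::finite, 'k::field) mpoly set"
  assumes "generated_by_linear_forms P"
  shows "has_mult (linear_dim P) P 1"
proof (cases "linear_dim P")
  case 0
  then have "std_vars P = {}" by (simp add: linear_dim_def)
  then have "Std P = {0}" unfolding linear_Std[OF assms]
    by (auto simp: cone_def intro!: poly_mapping_eqI)
  then show ?thesis by (simp add: has_mult_def 0)
next
  case (Suc r)
  then show ?thesis using cone_asymptotics_full[of "std_vars P" r 0]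
    by (simp add: has_mult_def linear_Std[OF assms] linear_dim_def)
qed

text \<open>Reads \<open>linear_dim P\<close> as the dimension of the degree 1 part of the quotient,
  so that linear algebra in degree 1 applies to it.\<close>

lemma card_Std_deg_1: "card (Std_deg P 1) = linear_dim P"
proof -
  have "Std_deg P 1 = (\<lambda>i. single i 1) ` std_vars P"
  proof (intro equalityI subsetI)
    fix m assume m: "m \<in> Std_deg P 1"
    then obtain i where "m = single i 1" using mon_deg_1E by blast
    then show "m \<in> (\<lambda>i. single i 1) ` std_vars P" using m by (simp add: std_vars_def del: One_nat_def)
  qed (auto simp: std_vars_def simp del: One_nat_def)
  moreover have "inj_on (\<lambda>i. single i (1::nat)) (std_vars P)"
    by (rule inj_onI) (metis lookup_single_eq lookup_single_not_eq zero_neq_one)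
  ultimately show ?thesis by (simp add: card_image linear_dim_def)
qed

lemma zero_in_Std:
  fixes J :: "('n::finite, 'k::field) mpoly set"
  assumes J: "is_ideal J" "J \<noteq> UNIV"
  shows "0 \<in> Std J"
proof -
  have "lm f \<noteq> 0" if f: "f \<in> J" "f \<noteq> 0" for f
  proof
    assume "lm f = 0"
    have "m = 0" if "m \<in> keys f" for m
      using lm_max[OF that] mon_key_le_add[of 0 m] \<open>lm f = 0\<close> by (metis add_0 antisym mon_key_inject)
    then have "keys f = {0}" using f(2) lm_in_keys \<open>lm f = 0\<close> by fastforce
    then have "f = single 0 (lookup f 0)" "lookup f 0 \<noteq> 0"
      using poly_sum_single[of f] by (simp, auto simp: in_keys_iff set_eq_iff)
    then have "single 0 (inverse (lookup f 0)) * f = 1"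
      by (metis mult_single add_0 left_inverse single_one)
    then have "1 \<in> J" using ideal_mult[OF J(1) f(1)] by metis
    then show False using J ideal_UNIV_iff by blast
  qed
  then show ?thesis by (auto simp: Std_def)
qed

text \<open>The dimension count is the exact sequence for multiplication by l in degree 1. Its first
  term is the degree 0 part of S/(P : l), which is one-dimensional because l is not in P.\<close>

lemma linear_insert:
  fixes P :: "('n::finite, 'k::field) mpoly set"
  assumes lin: "generated_by_linear_forms P" and l: "l \<in> forms 1" "l \<notin> P"
  shows "generated_by_linear_forms (ideal_gen (insert l P))"
    "linear_dim P = Suc (linear_dim (ideal_gen (insert l P)))"
proof -
  obtain L where L: "L \<subseteq> forms 1" "P = ideal_gen L"
    using lin by (auto simp: generated_by_linear_forms_def)
  show "generated_by_linear_forms (ideal_gen (insert l P))"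
    unfolding generated_by_linear_forms_def L(2) ideal_gen_insert_absorb
    using L(1) l(1) by (intro exI[of _ "insert l L"]) simp
  have P: "is_ideal P" by (rule linear_ideal[OF lin])
  have "0 \<in> Std (colon P l)"
    using P l(2) by (intro zero_in_Std) (auto simp: is_ideal_colon colon_UNIV_iff)
  then have "Std_deg (colon P l) 0 = {0}" by (auto simp: mon_deg_eq_0_iff)
  then have "card (Std_deg P 1) = 1 + card (Std_deg (ideal_gen (insert l P)) 1)"
    using hilbert_fun_exact[OF linear_graded[OF lin] l(1), of 0] by simp
  then show "linear_dim P = Suc (linear_dim (ideal_gen (insert l P)))"
    by (simp only: card_Std_deg_1)
qed

section \<open>Chains of primes and flags of linear primes\<close>

lemma prime_chain_0: "prime_ideal P \<Longrightarrow> prime_chain 0 (\<lambda>_. P)"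
  by (simp add: prime_chain_def)

lemma prime_chain_Suc:
  assumes "prime_ideal P" "P \<subset> c 0" "prime_chain n c"
  shows "prime_chain (Suc n) (case_nat P c)"
  using assms by (auto simp: prime_chain_def split: nat.split)

text \<open>The entry c n is replaced by c' 0, so the length is n + m whether or not the two
  coincide.\<close>

lemma prime_chain_append:
  assumes c: "prime_chain n c" and c': "prime_chain m c'" and "c n \<subseteq> c' 0"
  shows "prime_chain (n + m) (\<lambda>i. if i < n then c i else c' (i - n))"
  unfolding prime_chain_def
proof (intro conjI allI impI)
  fix i assume "i \<le> n + m"
  then show "prime_ideal (if i < n then c i else c' (i - n))"
    using c c' by (auto simp: prime_chain_def)
next
  fix i assume i: "i < n + m"
  consider "Suc i < n" | "Suc i = n" | "n \<le> i" by linarith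
  then show "(if i < n then c i else c' (i - n)) \<subset> (if Suc i < n then c (Suc i) else c' (Suc i - n))"
  proof cases
    case 2
    then have "c i \<subset> c n" using c by (auto simp: prime_chain_def)
    then show ?thesis using assms(3) 2 by auto
  next
    case 3
    then have "c' (i - n) \<subset> c' (Suc (i - n))" using c' i by (auto simp: prime_chain_def)
    then show ?thesis using 3 by (simp add: Suc_diff_le)
  qed (use c in \<open>auto simp: prime_chain_def\<close>)
qed

text \<open>Adjoin linear forms of Q to P one at a time; each new one gives a larger linear prime
  inside Q and lowers the dimension by exactly one.\<close>

lemma linear_flag:
  fixes P Q :: "('n::finite, 'k::field) mpoly set"
  assumes "generated_by_linear_forms P" and Q: "generated_by_linear_forms Q" and "P \<subseteq> Q"
  shows "\<exists>n c. linear_dim P = n + linear_dim Q \<and> prime_chain n c \<and> c 0 = P \<and> c n = Q"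
  using assms(1,3)
proof (induction "linear_dim P" arbitrary: P rule: less_induct)
  case (less P)
  show ?case
  proof (cases "P = Q")
    case True
    then show ?thesis using prime_chain_0[OF linear_prime[OF Q]] by fastforce
  next
    case False
    obtain L where L: "L \<subseteq> forms 1" "Q = ideal_gen L"
      using Q by (auto simp: generated_by_linear_forms_def)
    have "\<not> L \<subseteq> P"
      using False less.prems(2) ideal_gen_minimal[OF linear_ideal[OF less.prems(1)]] L(2) by blast
    then obtain l where l: "l \<in> L" "l \<notin> P" by blast
    define P' where "P' = ideal_gen (insert l P)"
    have lin: "generated_by_linear_forms P'" "linear_dim P = Suc (linear_dim P')"
      using linear_insert[OF less.prems(1) _ l(2)] l(1) L(1) by (auto simp: P'_def)
    have "P' \<subseteq> Q" unfolding P'_def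
      using l(1) L(2) ideal_gen_superset[of L] less.prems(2) linear_ideal[OF Q]
      by (intro ideal_gen_minimal) auto
    then obtain n c where c: "linear_dim P' = n + linear_dim Q" "prime_chain n c" "c 0 = P'" "c n = Q"
      using less.hyps[of P'] lin by auto
    have "P \<subset> c 0" using c(3) l(2) ideal_gen_superset[of "insert l P"] by (auto simp: P'_def)
    then have "prime_chain (Suc n) (case_nat P c)"
      using linear_prime[OF less.prems(1)] c(2) by (intro prime_chain_Suc)
    then show ?thesis using c lin(2) by (intro exI[of _ "Suc n"] exI[of _ "case_nat P c"]) simp
  qed
qed

lemma linear_zero: "generated_by_linear_forms {0 :: ('n::finite, 'k::field) mpoly}"
  "linear_dim {0 :: ('n, 'k) mpoly} = card (UNIV :: 'n set)"
proof -
  have "ideal_gen {} = {0 :: ('n, 'k) mpoly}"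
    by (simp add: ideal_gen_def module.span_empty[OF module_mult])
  then show "generated_by_linear_forms {0 :: ('n, 'k) mpoly}"
    unfolding generated_by_linear_forms_def by (intro exI[of _ "{}"]) simp
  show "linear_dim {0 :: ('n, 'k) mpoly} = card (UNIV :: 'n set)"
    by (simp add: linear_dim_def std_vars_def Std_def)
qed

lemma tvar_in_irrelevant: "tvar i \<in> irrelevant_ideal"
  unfolding irrelevant_ideal_def by (rule subsetD[OF ideal_gen_superset]) blast

lemma linear_irrelevant: "generated_by_linear_forms (irrelevant_ideal :: ('n::finite, 'k::field) mpoly set)"
  "linear_dim (irrelevant_ideal :: ('n::finite, 'k::field) mpoly set) = 0"
proof -
  show "generated_by_linear_forms (irrelevant_ideal :: ('n, 'k) mpoly set)"
    unfolding generated_by_linear_forms_def irrelevant_ideal_def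
    using tvar_in_forms by (intro exI[of _ "{tvar i | i. True}"]) auto
  have "tvar i \<in> (irrelevant_ideal :: ('n, 'k) mpoly set)" for i
    by (rule tvar_in_irrelevant)
  moreover have "lm (tvar i :: ('n, 'k) mpoly) = single i 1" for i by (simp add: tvar_def lm_single)
  moreover have "tvar i \<noteq> (0 :: ('n, 'k) mpoly)" for i
    by (metis tvar_def keys_single keys_zero insert_not_empty one_neq_zero)
  ultimately have "std_vars (irrelevant_ideal :: ('n, 'k) mpoly set) = {}"
    by (auto simp: std_vars_def Std_def)
  then show "linear_dim (irrelevant_ideal :: ('n, 'k) mpoly set) = 0" by (simp add: linear_dim_def)
qed

lemma linear_subset_irrelevant: "generated_by_linear_forms P \<Longrightarrow> P \<subseteq> (irrelevant_ideal :: ('n::finite, 'k::field) mpoly set)"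
proof -
  have "f \<in> irrelevant_ideal" if "f \<in> forms 1" for f :: "('n, 'k) mpoly"
  proof -
    have I: "is_ideal (irrelevant_ideal :: ('n, 'k) mpoly set)"
      by (simp add: irrelevant_ideal_def is_ideal_ideal_gen)
    have "single m (lookup f m) \<in> irrelevant_ideal" if m: "m \<in> keys f" for m
    proof -
      have "mon_deg m = 1" using m \<open>f \<in> forms 1\<close> by (auto simp: forms_def)
      then obtain i where "m = single i 1" by (rule mon_deg_1E)
      then have "single m (lookup f m) = kscale (lookup f m) (tvar i)" by (simp only: tvar_def kscale_single)
      then show ?thesis using kscale_in_ideal[OF I tvar_in_irrelevant] by simp
    qed
    then have "(\<Sum>m\<in>keys f. single m (lookup f m)) \<in> irrelevant_ideal" by (rule ideal_sum[OF I])
    then show ?thesis using poly_sum_single[of f] by simp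
  qed
  moreover assume "generated_by_linear_forms P"
  ultimately show ?thesis
    unfolding generated_by_linear_forms_def
    using ideal_gen_minimal[OF linear_ideal[OF linear_irrelevant(1)]] by (metis subset_iff)
qed

section \<open>Krull dimension\<close>

definition indep_mod :: "('n, 'k::field) mpoly set \<Rightarrow> ('n, 'k) mpoly set \<Rightarrow> bool"
  where "indep_mod W B \<longleftrightarrow> finite B \<and> (\<forall>c. (\<Sum>b\<in>B. kscale (c b) b) \<in> W \<longrightarrow> (\<forall>b\<in>B. c b = 0))"

lemma indep_mod_image:
  fixes h :: "'i \<Rightarrow> ('n, 'k::field) mpoly"
  assumes D: "finite D" and W: "0 \<in> W"
    and ind: "\<And>c i. (\<Sum>i\<in>D. kscale (c i) (h i)) \<in> W \<Longrightarrow> i \<in> D \<Longrightarrow> c i = 0"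
  shows "inj_on h D" "indep_mod W (h ` D)"
proof -
  interpret vector_space "kscale :: 'k \<Rightarrow> ('n, 'k) mpoly \<Rightarrow> ('n, 'k) mpoly"
    by (rule vector_space_kscale)
  show inj: "inj_on h D"
  proof (rule inj_onI, rule ccontr)
    fix x y assume xy: "x \<in> D" "y \<in> D" "h x = h y" "x \<noteq> y"
    let ?c = "\<lambda>z. if z = x then 1 else if z = y then - 1 else (0::'k)"
    have "(\<Sum>z\<in>D. kscale (?c z) (h z)) = (\<Sum>z\<in>{x, y}. kscale (?c z) (h z))"
      using xy D by (intro sum.mono_neutral_right) auto
    also have "\<dots> = 0" using xy by simp
    finally have "(\<Sum>z\<in>D. kscale (?c z) (h z)) \<in> W" using W by simp
    from ind[OF this xy(1)] show False by simp
  qed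
  show "indep_mod W (h ` D)"
    unfolding indep_mod_def using D ind[of "\<lambda>i. _ (h i)"] by (auto simp: sum.reindex[OF inj])
qed

text \<open>Steinitz exchange in a quotient: each b is replaced by a congruent p b in the span of C,
  and the p b are independent in S itself.\<close>

lemma indep_mod_card_le:
  fixes B C :: "('n, 'k::field) mpoly set"
  assumes W: "module.subspace kscale W" and B: "indep_mod W B" and C: "finite C"
    and span: "\<And>b. b \<in> B \<Longrightarrow> \<exists>p\<in>module.span kscale C. b - p \<in> W"
  shows "card B \<le> card C"
proof -
  interpret vector_space "kscale :: 'k \<Rightarrow> ('n, 'k) mpoly \<Rightarrow> ('n, 'k) mpoly"
    by (rule vector_space_kscale)
  obtain p where p: "\<And>b. b \<in> B \<Longrightarrow> p b \<in> span C" "\<And>b. b \<in> B \<Longrightarrow> b - p b \<in> W"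
    using span by metis
  have fin: "finite B" using B by (simp add: indep_mod_def)
  have zero: "c b = 0" if "(\<Sum>b\<in>B. kscale (c b) (p b)) \<in> {0}" "b \<in> B" for c b
  proof -
    have "(\<Sum>b\<in>B. kscale (c b) b) = (\<Sum>b\<in>B. kscale (c b) (b - p b))"
      using that(1) by (simp add: scale_right_diff_distrib sum_subtractf)
    also have "\<dots> \<in> W" using p(2) W by (intro subspace_sum_kscale)
    finally show ?thesis using B that(2) by (simp add: indep_mod_def)
  qed
  have inj: "inj_on p B" and ind: "indep_mod {0} (p ` B)"
    using indep_mod_image[of B "{0}" p] zero fin by auto
  have "independent (p ` B)"
    unfolding independent_explicit_module
  proof (intro allI impI)
    fix t u v
    assume t: "finite t" "t \<subseteq> p ` B" "(\<Sum>v\<in>t. kscale (u v) v) = 0" "v \<in> t"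
    have "(\<Sum>y\<in>p ` B. kscale (if y \<in> t then u y else 0) y) = (\<Sum>y\<in>t. kscale (u y) y)"
      using t fin by (intro sum.mono_neutral_cong_right) auto
    then have "(\<Sum>y\<in>p ` B. kscale (if y \<in> t then u y else 0) y) \<in> {0}" using t(3) by simp
    from ind[unfolded indep_mod_def, THEN conjunct2, THEN spec, THEN mp, OF this]
    have "\<forall>y\<in>p ` B. (if y \<in> t then u y else 0) = 0" .
    then show "u v = 0" using t(2,4) by force
  qed
  then have "card (p ` B) \<le> card C"
    using independent_span_bound[OF C, of "p ` B"] p(1) by blast
  then show ?thesis using inj by (simp add: card_image)
qed

text \<open>Peel off the lowest power. The sum lies in P' and so do all terms containing f, hence g
  0 lies in P' and is 0. What is left is a multiple of f, and f can be cancelled modulo the prime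
  P.\<close>

lemma prime_step_zero:
  fixes P :: "'a::comm_ring_1 set"
  assumes P: "prime_ideal P" and P': "is_ideal P'" "P \<subseteq> P'" and f: "f \<in> P'" "f \<notin> P"
  shows "(\<And>a. g a \<in> P' \<Longrightarrow> g a = 0) \<Longrightarrow> (\<Sum>a<N. f ^ a * g a) \<in> P \<Longrightarrow> a < N \<Longrightarrow> g a = 0"
proof (induction N arbitrary: g a)
  case (Suc N)
  let ?s = "\<Sum>a<N. f ^ a * g (Suc a)"
  have eq: "(\<Sum>a<Suc N. f ^ a * g a) = g 0 + f * ?s"
    by (simp add: sum.lessThan_Suc_shift sum_distrib_left mult.assoc del: sum.lessThan_Suc)
  then have "g 0 + f * ?s \<in> P'" using Suc.prems(2) P'(2) by auto
  then have "g 0 \<in> P'" using ideal_diff[OF P'(1) _ ideal_mult2[OF P'(1) f(1)], of "g 0 + f * ?s" ?s] by simp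
  then have g0: "g 0 = 0" using Suc.prems(1) by blast
  then have "f * ?s \<in> P" using Suc.prems(2) eq by simp
  then have "?s \<in> P" using P f(2) by (auto simp: prime_ideal_def)
  then show ?case using Suc.IH[of "\<lambda>a. g (Suc a)" "a - 1"] Suc.prems(1,3) g0 by (cases a) auto
qed simp

text \<open>One step down a chain of primes multiplies the size of an independent set by N. The
  coefficients of the powers of f are combinations of B, which vanish as soon as they lie in
  P'.\<close>

lemma indep_mod_powers:
  fixes P :: "('n::finite, 'k::field) mpoly set"
  assumes P: "prime_ideal P" and P': "is_ideal P'" "P \<subseteq> P'" and f: "f \<in> P'" "f \<notin> P"
    and B: "indep_mod P' B"
  shows "indep_mod P ((\<lambda>(a, b). f ^ a * b) ` ({..<N} \<times> B))"
    "card ((\<lambda>(a, b). f ^ a * b) ` ({..<N} \<times> B)) = N * card B"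
proof -
  have fin: "finite B" using B by (simp add: indep_mod_def)
  have zero: "c i = 0" if c: "(\<Sum>i\<in>{..<N} \<times> B. kscale (c i) (case i of (a, b) \<Rightarrow> f ^ a * b)) \<in> P"
    and i: "i \<in> {..<N} \<times> B" for c i
  proof -
    let ?g = "\<lambda>a. \<Sum>b\<in>B. kscale (c (a, b)) b"
    have g: "\<forall>b\<in>B. c (a, b) = 0" if "?g a \<in> P'" for a
      using B that unfolding indep_mod_def by (elim conjE allE[of _ "\<lambda>b. c (a, b)"]) blast
    have "(\<Sum>i\<in>{..<N} \<times> B. kscale (c i) (case i of (a, b) \<Rightarrow> f ^ a * b)) = (\<Sum>a<N. f ^ a * ?g a)"
      by (simp add: sum.cartesian_product' sum_distrib_left kscale_def ac_simps)
    with c have "(\<Sum>a<N. f ^ a * ?g a) \<in> P" by simp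
    moreover have "?g a = 0" if "?g a \<in> P'" for a using g[OF that] by simp
    moreover have "fst i < N" using i by auto
    ultimately have "?g (fst i) = 0" by (intro prime_step_zero[OF P P' f, of ?g N "fst i"])
    then have "?g (fst i) \<in> P'" using ideal_0[OF P'(1)] by simp
    from g[OF this] show ?thesis using i by (cases i) auto
  qed
  have "is_ideal P" using P by (simp add: prime_ideal_def)
  then show "indep_mod P ((\<lambda>(a, b). f ^ a * b) ` ({..<N} \<times> B))"
    using fin zero by (intro indep_mod_image) (auto intro: ideal_0)
  have "inj_on (\<lambda>(a, b). f ^ a * b) ({..<N} \<times> B)"
    using fin zero \<open>is_ideal P\<close> by (intro indep_mod_image[where W = P]) (auto intro: ideal_0)
  then show "card ((\<lambda>(a, b). f ^ a * b) ` ({..<N} \<times> B)) = N * card B"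
    by (simp add: card_image card_cartesian_product)
qed

text \<open>Bounding every exponent separately, instead of the total degree, makes the number of
  admissible monomials at most a plain power \<open>Suc b ^ s\<close> for s variables.\<close>

definition exps_le :: "nat \<Rightarrow> ('n::finite, 'k::field) mpoly \<Rightarrow> bool"
  where "exps_le b f \<longleftrightarrow> (\<forall>m\<in>keys f. \<forall>i. lookup m i \<le> b)"

lemma exps_le_mono: "exps_le b f \<Longrightarrow> b \<le> b' \<Longrightarrow> exps_le b' f"
  by (meson exps_le_def le_trans)

lemma exps_le_mult: "exps_le a f \<Longrightarrow> exps_le b g \<Longrightarrow> exps_le (a + b) (f * g)"
  unfolding exps_le_def using keys_mult[of f g] by (fastforce simp: lookup_add intro: add_mono)

lemma exps_le_1: "exps_le b 1"
  by (simp add: exps_le_def)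

lemma exps_le_power: "exps_le a f \<Longrightarrow> exps_le (k * a) (f ^ k)"
  by (induction k) (auto intro: exps_le_mult exps_le_1)

lemma ex_exps_le: "\<exists>b. exps_le b f"
proof -
  have "finite (\<Union>m\<in>keys f. range (lookup m))" by simp
  then have "\<exists>b. \<forall>x\<in>(\<Union>m\<in>keys f. range (lookup m)). x \<le> b"
    by (meson finite_nat_set_iff_bounded_le)
  then show ?thesis by (auto simp: exps_le_def)
qed

lemma card_mon_bounded: "card {m :: 'n::finite \<Rightarrow>\<^sub>0 nat. \<forall>i. lookup m i \<le> b} \<le> Suc b ^ card (UNIV :: 'n set)"
proof -
  let ?A = "{m :: 'n \<Rightarrow>\<^sub>0 nat. \<forall>i. lookup m i \<le> b}"
  have "card ?A = card (lookup ` ?A)" by (rule card_image[symmetric]) (simp add: inj_on_def)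
  also have "\<dots> \<le> card (UNIV \<rightarrow>\<^sub>E {..b} :: ('n \<Rightarrow> nat) set)"
    by (intro card_mono finite_PiE) (auto simp: PiE_def)
  also have "\<dots> = Suc b ^ card (UNIV :: 'n set)" by (simp add: card_PiE)
  finally show ?thesis .
qed

lemma indep_mod_exps_le:
  fixes P :: "('n::finite, 'k::field) mpoly set"
  assumes P: "is_ideal P" and B: "indep_mod P B" "\<And>b. b \<in> B \<Longrightarrow> exps_le e b"
  shows "card B \<le> Suc e ^ card (UNIV :: 'n set)"
proof -
  let ?M = "{m :: 'n \<Rightarrow>\<^sub>0 nat. \<forall>i. lookup m i \<le> e}"
  have "card B \<le> card ((\<lambda>m. single m (1::'k)) ` ?M)"
  proof (rule indep_mod_card_le[OF subspace_ideal[OF P] B(1)])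
    fix b assume "b \<in> B"
    then have "keys b \<subseteq> ?M" using B(2) by (auto simp: exps_le_def)
    then have "(\<Sum>m\<in>keys b. kscale (lookup b m) (single m 1)) \<in> module.span kscale ((\<lambda>m. single m (1::'k)) ` ?M)"
      by (intro module.span_sum module.span_scale module.span_base module_kscale) auto
    then have "b \<in> module.span kscale ((\<lambda>m. single m (1::'k)) ` ?M)"
      using poly_sum_single[of b] by (simp add: kscale_single)
    then show "\<exists>p\<in>module.span kscale ((\<lambda>m. single m (1::'k)) ` ?M). b - p \<in> P"
      using ideal_0[OF P] by (intro bexI[of _ b]) auto
  qed (use finite_mon_bounded in auto)
  also have "\<dots> \<le> Suc e ^ card (UNIV :: 'n set)"
    unfolding card_single_image by (rule card_mon_bounded)
  finally show ?thesis .
qed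

text \<open>If a chain were too long, the monomials in elements \<open>f i \<in> c (Suc i) - c i\<close> would be
  independent modulo \<open>c 0\<close>, and there are too many of them.\<close>

lemma prime_chain_length:
  fixes c :: "nat \<Rightarrow> ('n::finite, 'k::field) mpoly set"
  assumes c: "prime_chain n c"
  shows "n \<le> card (UNIV :: 'n set)"
proof (rule ccontr)
  define s where "s = card (UNIV :: 'n set)"
  assume "\<not> ?thesis"
  then have n: "s < n" by (simp add: s_def)
  have prime: "prime_ideal (c i)" and sub: "i < n \<Longrightarrow> c i \<subset> c (Suc i)" if "i \<le> n" for i
    using c that by (auto simp: prime_chain_def)
  have ideal: "is_ideal (c i)" if "i \<le> n" for i using prime[OF that] by (simp add: prime_ideal_def)
  have "\<forall>i. \<exists>f. i < n \<longrightarrow> f \<in> c (Suc i) \<and> f \<notin> c i" using sub by (meson less_imp_le psubset_imp_ex_mem DiffD1 DiffD2)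
  then obtain f where f: "\<And>i. i < n \<Longrightarrow> f i \<in> c (Suc i) \<and> f i \<notin> c i" by metis
  have "\<forall>i. \<exists>b. exps_le b (f i)" using ex_exps_le by blast
  then obtain e' where e': "\<And>i. exps_le (e' i) (f i)" by metis
  define e where "e = (\<Sum>i<n. e' i)"
  have e: "exps_le e (f i)" if "i < n" for i
    using that by (intro exps_le_mono[OF e']) (auto simp: e_def intro: member_le_sum)
  \<comment> \<open>B consists of the products of powers f i ^ a with a < N over the last j indices
    i. Each factor has exponents at most N * e, whence the bound.\<close>
  have "\<exists>B. indep_mod (c (n - j)) B \<and> card B = N ^ j \<and> (\<forall>b\<in>B. exps_le (j * (N * e)) b)" if "j \<le> n" for j N
    using that
  proof (induction j)
    case 0
    \<comment> \<open>A proper ideal contains no nonzero constant, so {1} is independent modulo c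
      n.\<close>
    have "single 0 a = (0 :: ('n, 'k) mpoly)" if "single 0 a \<in> c n" for a
    proof (rule ccontr)
      assume "single 0 a \<noteq> (0 :: ('n, 'k) mpoly)"
      then have "a \<noteq> 0" by auto
      then have "single 0 (inverse a) * single 0 a = (1 :: ('n, 'k) mpoly)"
        by (simp add: mult_single)
      then have "1 \<in> c n" using ideal_mult[OF ideal[OF order_refl] that, of "single 0 (inverse a)"] by simp
      then show False using prime[of n] ideal_UNIV_iff[OF ideal, of n] by (simp add: prime_ideal_def)
    qed
    then have "indep_mod (c n) {1}"
      by (auto simp: indep_mod_def kscale_def) (metis lookup_single_eq lookup_zero)
    then show ?case by (intro exI[of _ "{1}"]) (auto simp: exps_le_1)
  next
    case (Suc j)
    define i where "i = n - Suc j"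
    have i: "Suc i = n - j" "i < n" using Suc.prems by (auto simp: i_def)
    obtain B where B: "indep_mod (c (Suc i)) B" "card B = N ^ j" "\<And>b. b \<in> B \<Longrightarrow> exps_le (j * (N * e)) b"
      using Suc i by auto
    let ?B = "(\<lambda>(a, b). f i ^ a * b) ` ({..<N} \<times> B)"
    have "indep_mod (c i) ?B" "card ?B = N * card B"
      using indep_mod_powers[OF _ _ _ _ _ B(1), of "c i" "f i" N] prime[of i] ideal[of "Suc i"] sub[of i]
        f[of i] i(2) by (simp_all add: less_imp_le Suc_le_eq psubset_imp_subset)
    moreover have "exps_le (Suc j * (N * e)) b" if b: "b \<in> ?B" for b
    proof -
      obtain a b' where ab: "a < N" "b' \<in> B" "b = f i ^ a * b'" using b by auto
      have "exps_le (N * e) (f i ^ a)"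
        by (rule exps_le_mono[OF exps_le_power[OF e[OF i(2)], of a]]) (use ab(1) in simp)
      from exps_le_mult[OF this B(3)[OF ab(2)]] show ?thesis by (simp add: ab(3))
    qed
    ultimately show ?case using B(2) by (intro exI[of _ ?B]) (auto simp: i_def)
  qed
  note family = this
  \<comment> \<open>The exponents are at most n N e, which is less than N d, so counting gives N^n
    <= (N d)^s = N^s d^s. Taking N > d^s makes the right side smaller than N^(s + 1) <= N^n.\<close>
  define d where "d = Suc (n * e)"
  define N where "N = Suc (d ^ s)"
  obtain B where B: "indep_mod (c 0) B" "card B = N ^ n" "\<And>b. b \<in> B \<Longrightarrow> exps_le (n * (N * e)) b"
    using family[of n N] by auto
  have "N ^ n \<le> Suc (n * (N * e)) ^ s"
    using indep_mod_exps_le[OF ideal B(1,3)] B(2) by (simp add: s_def)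
  also have "\<dots> \<le> (N * d) ^ s"
  proof (intro power_mono)
    have "0 < N" by (simp add: N_def)
    then show "Suc (n * (N * e)) \<le> N * d" by (simp add: d_def algebra_simps)
  qed simp
  also have "\<dots> = N ^ s * d ^ s" by (rule power_mult_distrib)
  also have "\<dots> < N ^ s * N" by (simp add: N_def)
  also have "\<dots> \<le> N ^ n" using n power_increasing[of "Suc s" n N] by (simp add: N_def mult.commute)
  finally show False by simp
qed

section \<open>Heights and dimensions via linear primes\<close>

lemma linear_chain_to:
  fixes P :: "('n::finite, 'k::field) mpoly set"
  assumes "generated_by_linear_forms P"
  shows "\<exists>n c. card (UNIV :: 'n set) = n + linear_dim P \<and> prime_chain n c \<and> c n = P"
proof -
  have "{0} \<subseteq> P" using ideal_0[OF linear_ideal[OF assms]] by simp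
  from linear_flag[OF linear_zero(1) assms this] show ?thesis unfolding linear_zero(2) by blast
qed

lemma linear_chain_from:
  fixes P :: "('n::finite, 'k::field) mpoly set"
  assumes "generated_by_linear_forms P"
  shows "\<exists>c. prime_chain (linear_dim P) c \<and> c 0 = P"
  using linear_flag[OF assms linear_irrelevant(1) linear_subset_irrelevant[OF assms]]
  unfolding linear_irrelevant(2) by auto

text \<open>A chain ending at P extends by a flag of length \<open>linear_dim P\<close> up to the
  irrelevant ideal, and the total length is at most s. A flag from (0) to P attains the resulting
  bound.\<close>

lemma height_linear:
  fixes P :: "('n::finite, 'k::field) mpoly set"
  assumes "generated_by_linear_forms P"
  shows "height P = enat (card (UNIV :: 'n set) - linear_dim P)"
proof (rule antisym)
  obtain c' where c': "prime_chain (linear_dim P) c'" "c' 0 = P" using linear_chain_from[OF assms] by blast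
  show "height P \<le> enat (card (UNIV :: 'n set) - linear_dim P)"
    unfolding height_def
  proof (rule Sup_least, clarify)
    fix n c assume c: "prime_chain n c" "P = c n"
    then have "prime_chain (n + linear_dim P) (\<lambda>i. if i < n then c i else c' (i - n))"
      using c' by (intro prime_chain_append) auto
    from prime_chain_length[OF this]
    show "enat n \<le> enat (card (UNIV :: 'n set) - linear_dim (c n))" using c(2) by simp
  qed
  obtain n c where "card (UNIV :: 'n set) = n + linear_dim P" "prime_chain n c" "c n = P"
    using linear_chain_to[OF assms] by blast
  then show "enat (card (UNIV :: 'n set) - linear_dim P) \<le> height P"
    unfolding height_def by (intro Sup_upper) auto
qed

lemma linear_dim_le: "generated_by_linear_forms (P :: ('n::finite, 'k::field) mpoly set) \<Longrightarrow>
    linear_dim P \<le> card (UNIV :: 'n set)"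
  using linear_chain_to[of P] by auto

text \<open>For the upper bound, a chain above J starts at a prime containing a linear prime P' of
  dimension t. A flag of length s - t from (0) to P' put in front leaves room for at most t
  steps.\<close>

lemma krull_dim_quot_linear:
  fixes J P :: "('n::finite, 'k::field) mpoly set"
  assumes P: "generated_by_linear_forms P" "J \<subseteq> P" "linear_dim P = t"
    and below: "\<And>Q. prime_ideal Q \<Longrightarrow> J \<subseteq> Q \<Longrightarrow>
      \<exists>P. generated_by_linear_forms P \<and> linear_dim P = t \<and> P \<subseteq> Q"
  shows "krull_dim_quot J = enat t"
proof (rule antisym)
  obtain c where "prime_chain t c" "c 0 = P" using linear_chain_from[OF P(1)] P(3) by blast
  then show "enat t \<le> krull_dim_quot J"
    unfolding krull_dim_quot_def using P(2) by (intro Sup_upper) auto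
  show "krull_dim_quot J \<le> enat t"
    unfolding krull_dim_quot_def
  proof (rule Sup_least, clarify)
    fix n c assume c: "prime_chain n c" "J \<subseteq> c 0"
    then obtain P' where P': "generated_by_linear_forms P'" "linear_dim P' = t" "P' \<subseteq> c 0"
      using below[of "c 0"] by (auto simp: prime_chain_def)
    obtain m c' where c': "card (UNIV :: 'n set) = m + t" "prime_chain m c'" "c' m = P'"
      using linear_chain_to[OF P'(1)] P'(2) by blast
    have "prime_chain (m + n) (\<lambda>i. if i < m then c' i else c (i - m))"
      using c' c(1) P'(3) by (intro prime_chain_append) auto
    from prime_chain_length[OF this] show "enat n \<le> enat t" using c'(1) by simp
  qed
qed

text \<open>A linear relation modulo P among the variables in T would be an element of P and of
  K[T]. So these variables are independent in the degree 1 part of S/P, whose dimension is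
  \<open>linear_dim P\<close>.\<close>

lemma card_le_linear_dim:
  fixes P :: "('n::finite, 'k::field) mpoly set"
  assumes P: "generated_by_linear_forms P" and T: "P \<inter> polys_in T \<subseteq> {0}"
  shows "card T \<le> linear_dim P"
proof -
  have tv: "lookup (\<Sum>i\<in>T. kscale (c i) (tvar i)) (single j 1) = (if j \<in> T then c j else 0)"
    for c :: "'n \<Rightarrow> 'k" and j
  proof -
    have "single i (1::nat) = single j 1 \<longleftrightarrow> i = j" for i :: 'n
      by (metis lookup_single_eq lookup_single_not_eq zero_neq_one)
    then have "lookup (\<Sum>i\<in>T. kscale (c i) (tvar i)) (single j 1) = (\<Sum>i\<in>T. if i = j then c j else 0)"
      unfolding lookup_sum by (intro sum.cong) (auto simp: tvar_def kscale_single lookup_single when_def)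
    then show ?thesis by simp
  qed
  have zero: "c i = 0" if c: "(\<Sum>i\<in>T. kscale (c i) (tvar i)) \<in> P" and "i \<in> T" for c i
  proof -
    have "(\<Sum>i\<in>T. kscale (c i) (tvar i)) \<in> polys_in T"
      by (intro polys_in_sum) (auto simp: polys_in_def tvar_def kscale_single)
    then have "(\<Sum>i\<in>T. kscale (c i) (tvar i)) = 0" using c T by blast
    then show ?thesis using tv[of c i] \<open>i \<in> T\<close> by simp
  qed
  have gr: "graded_ideal P" and ideal: "is_ideal P" using P linear_graded linear_ideal by auto
  have inj: "inj_on (tvar :: 'n \<Rightarrow> ('n, 'k) mpoly) T" and ind: "indep_mod P (tvar ` T)"
    using indep_mod_image[of T P tvar] zero ideal_0[OF ideal] by auto
  have "card (tvar ` T :: ('n, 'k) mpoly set) \<le> card ((\<lambda>m. single m (1::'k)) ` Std_deg P 1)"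
  proof (rule indep_mod_card_le[OF subspace_ideal[OF ideal] ind])
    fix b :: "('n, 'k) mpoly" assume "b \<in> tvar ` T"
    then have "b \<in> forms 1" by (elim imageE) (simp only: tvar_in_forms)
    then obtain w where w: "w \<in> forms 1" "keys w \<subseteq> Std P" "b - w \<in> P"
      using normal_form_forms[OF gr] by blast
    have "(\<Sum>m\<in>keys w. kscale (lookup w m) (single m 1)) \<in> module.span kscale ((\<lambda>m. single m (1::'k)) ` Std_deg P 1)"
      using w(1,2) by (intro module.span_sum module.span_scale module.span_base module_kscale)
        (auto simp: forms_def)
    then show "\<exists>p\<in>module.span kscale ((\<lambda>m. single m (1::'k)) ` Std_deg P 1). b - p \<in> P"
      using w(3) poly_sum_single[of w] by (intro bexI[of _ w]) (simp_all add: kscale_single)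
  qed (use finite_Std_deg in auto)
  then show ?thesis unfolding card_single_image card_Std_deg_1 card_image[OF inj] .
qed

section \<open>Regularity index and v-number\<close>

text \<open>Unmixedness is recast as equality of the dimensions of the linear associated primes; the
  final theorem derives this from equal heights.\<close>

locale linear_unmixed =
  fixes I :: "('n::finite, 'k::field) mpoly set" and t :: nat
  assumes graded: "graded_ideal I"
    and proper: "I \<noteq> UNIV"
    and linear: "P \<in> Ass I \<Longrightarrow> generated_by_linear_forms P"
    and dim: "P \<in> Ass I \<Longrightarrow> linear_dim P = t"
begin

lemma ideal: "is_ideal I"
  using graded by (rule graded_imp_ideal)

lemma Ass_above_colon:
  assumes "g \<notin> I"
  shows "\<exists>P\<in>Ass I. colon I g \<subseteq> P"
proof -
  have "1 \<notin> colon I g" using assms by (simp add: mem_colon)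
  then have "\<exists>P\<in>Ass I. colon I g \<subseteq> P \<and> P \<inter> {1} = {}"
    by (intro ex_Ass_colon ideal) auto
  then show ?thesis by blast
qed

text \<open>A cone \<open>a + \<nat>\<^sup>T\<close> of standard monomials makes \<open>(I : t\<^sup>a f)\<close> disjoint from
  \<open>K[T] - {0}\<close>, so some associated prime meets \<open>K[T]\<close> trivially.\<close>

lemma ex_has_mult_colon: "\<exists>n. has_mult t (colon I f) n"
proof (rule ex_has_mult[OF is_ideal_colon[OF ideal]])
  fix a T assume cone: "cone a T \<subseteq> Std (colon I f)"
  define M where "M = {u :: ('n, 'k) mpoly. u \<noteq> 0 \<and> u \<in> polys_in T}"
  \<comment> \<open>Otherwise the product of u with the monomial of the apex a lies in (I : f),
    although its leading monomial a + \<open>lm u\<close> belongs to the cone and is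
    standard.\<close>
  have "u \<notin> colon I (single a 1 * f)" if "u \<in> M" for u
  proof
    assume "u \<in> colon I (single a 1 * f)"
    then have "single a 1 * u \<in> colon I f" by (simp add: mem_colon ac_simps)
    moreover have "single a (1::'k) \<noteq> 0" by (metis keys_single keys_zero insert_not_empty one_neq_zero)
    then have "single a 1 * u \<noteq> 0" using that by (intro mult_nonzero) (auto simp: M_def)
    moreover have "lm (single a 1 * u) = a + lm u" using that by (simp add: M_def lm_single_mult)
    moreover have "keys (lm u) \<subseteq> T" using that lm_in_keys[of u] by (auto simp: M_def polys_in_def)
    then have "a + lm u \<in> cone a T" by (simp add: cone_eq_image)
    ultimately show False using cone by (auto simp: Std_def)
  qed
  then have "\<exists>P\<in>Ass I. colon I (single a 1 * f) \<subseteq> P \<and> P \<inter> M = {}"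
    by (intro ex_Ass_colon ideal) (auto simp: M_def polys_in_mult mult_nonzero)
  then obtain P where P: "P \<in> Ass I" "P \<inter> polys_in T \<subseteq> {0}" by (auto simp: M_def)
  show "card T \<le> t" using card_le_linear_dim[OF linear[OF P(1)] P(2)] dim[OF P(1)] by simp
qed

text \<open>S/J surjects onto S/P, whose multiplicity in dimension t is 1.\<close>

lemma has_mult_ge_1:
  assumes "has_mult t J n" "P \<in> Ass I" "J \<subseteq> P"
  shows "1 \<le> n"
  using has_mult_antimono[OF assms(3,1)] has_mult_linear[OF linear[OF assms(2)]] dim[OF assms(2)] by simp

lemma has_mult_colon_ge_1: "g \<notin> I \<Longrightarrow> has_mult t (colon I g) n \<Longrightarrow> 1 \<le> n"
  using Ass_above_colon has_mult_ge_1 by blast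

lemma has_mult_colon_1_iff:
  assumes f: "f \<in> forms e" "f \<notin> I" and n: "has_mult t (colon I f) n"
  shows "n = 1 \<longleftrightarrow> prime_ideal (colon I f)"
proof
  assume "prime_ideal (colon I f)"
  then have "colon I f \<in> Ass I" by (auto simp: Ass_def)
  then show "n = 1" using has_mult_linear linear dim has_mult_unique[OF n] by metis
next
  assume n1: "n = 1"
  let ?J = "colon I f"
  have J: "graded_ideal ?J" by (rule graded_colon[OF graded f(1)])
  obtain P where P: "P \<in> Ass I" "?J \<subseteq> P" using Ass_above_colon f(2) by blast
  have "P \<subseteq> ?J"
  proof (rule ccontr)
    assume "\<not> P \<subseteq> ?J"
    then obtain g' where g': "g' \<in> P" "g' \<notin> ?J" by blast
    \<comment> \<open>Additivity of multiplicities is available for forms. As P is graded, some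
      component of g' lies in P but outside (I : f).\<close>
    have "\<exists>d. hom_component d g' \<notin> ?J"
      using g'(2) sum_hom_components[of g'] ideal_sum[OF graded_imp_ideal[OF J]] by metis
    then obtain d g where g: "g \<in> forms d" "g \<in> P" "g \<notin> ?J"
      using g'(1) hom_component_in_forms graded_hom_component[OF linear_graded[OF linear[OF P(1)]]] by blast
    obtain n' where n': "has_mult t (colon ?J g) n'"
      using ex_has_mult_colon[of "g * f"] by (auto simp: colon_colon)
    have "1 \<le> n'" using n' g(3) has_mult_colon_ge_1[of "g * f"] by (simp add: colon_colon mem_colon)
    moreover have "1 \<le> n - n'"
    proof (rule has_mult_ge_1[OF has_mult_exact[OF J g(1) n n'] P(1)])
      show "ideal_gen (insert g ?J) \<subseteq> P"
        using P g(2) linear_ideal[OF linear] by (intro ideal_gen_minimal) auto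
    qed
    ultimately show False using n1 by simp
  qed
  then show "prime_ideal ?J" using P linear_prime[OF linear] by (metis subset_antisym)
qed

text \<open>Used for I and for (I, f). A prime above J contains an associated prime of I, and these
  all have dimension t.\<close>

lemma krull_dim:
  assumes "I \<subseteq> J" "P \<in> Ass I" "J \<subseteq> P"
  shows "krull_dim_quot J = enat t"
proof (rule krull_dim_quot_linear[OF linear[OF assms(2)] assms(3) dim[OF assms(2)]])
  fix Q assume "prime_ideal Q" "J \<subseteq> Q"
  then obtain P' where "P' \<in> Ass I" "P' \<subseteq> Q"
    using ex_Ass_below_prime[OF ideal] assms(1) by blast
  then show "\<exists>P. generated_by_linear_forms P \<and> linear_dim P = t \<and> P \<subseteq> Q"
    using linear dim by blast
qed

text \<open>The multiplicity of S/(I : f) in dimension t. In particular \<open>mult 1\<close> is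
  that of S/I, as (I : 1) = I.\<close>

definition mult :: "('n, 'k) mpoly \<Rightarrow> nat"
  where "mult f = (THE n. has_mult t (colon I f) n)"

lemma has_mult_mult: "has_mult t (colon I f) (mult f)"
  unfolding mult_def using ex_has_mult_colon[of f] has_mult_unique by (metis theI)

lemma mult_ge_1: "f \<notin> I \<Longrightarrow> 1 \<le> mult f"
  using has_mult_colon_ge_1 has_mult_mult by blast

lemma mult_1_iff: "f \<in> forms e \<Longrightarrow> f \<notin> I \<Longrightarrow> mult f = 1 \<longleftrightarrow> prime_ideal (colon I f)"
  using has_mult_colon_1_iff has_mult_mult by blast

lemma has_mult_I: "has_mult t I (mult 1)"
  using has_mult_mult[of 1] by (simp add: colon_1)

lemma one_notin: "1 \<notin> I"
  using proper ideal_UNIV_iff[OF ideal] by simp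

lemma degree_quot_I: "degree_quot I = real (mult 1)"
proof -
  obtain P where "P \<in> Ass I" "colon I 1 \<subseteq> P" using Ass_above_colon[OF one_notin] by blast
  then have "krull_dim_quot I = enat t" by (intro krull_dim) (auto simp: colon_1)
  then show ?thesis by (rule degree_quot_eq[OF graded _ has_mult_I])
qed

text \<open>If g f is in I and g is not, an associated prime P above (I : g) contains f. So (I, f)
  lies below P, still has dimension t, and its degree is the difference given by the exact
  sequence.\<close>

lemma degree_quot_insert:
  assumes "f \<in> zero_divisor_forms I d"
  shows "degree_quot (ideal_gen (insert f I)) = real (mult 1) - real (mult f)"
proof -
  have f: "f \<in> forms d" "colon I f \<noteq> I" using assms by (auto simp: zero_divisor_forms_def)
  then obtain g where g: "g * f \<in> I" "g \<notin> I"
    using colon_superset[OF ideal, of f] by (auto simp: colon_def)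
  obtain P where P: "P \<in> Ass I" "colon I g \<subseteq> P" using Ass_above_colon[OF g(2)] by blast
  have "f \<in> P" using P(2) g(1) by (auto simp: mem_colon mult.commute)
  then have sub: "ideal_gen (insert f I) \<subseteq> P"
    using Ass_superset[OF ideal P(1)] linear_ideal[OF linear[OF P(1)]] by (intro ideal_gen_minimal) auto
  have "krull_dim_quot (ideal_gen (insert f I)) = enat t"
    using ideal_gen_superset[of "insert f I"] by (intro krull_dim[OF _ P(1) sub]) auto
  then have "degree_quot (ideal_gen (insert f I)) = real (mult 1 - mult f)"
    by (rule degree_quot_eq[OF graded_insert[OF graded f(1)] _
        has_mult_exact[OF graded f(1) has_mult_I has_mult_mult]])
  moreover have "mult f \<le> mult 1"
    using has_mult_antimono[OF colon_superset[OF ideal] has_mult_I has_mult_mult] .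
  ultimately show ?thesis by simp
qed

text \<open>Shows that the minima in \<open>reg_min_dist\<close> and \<open>v_number\<close> run
  over the same degrees when I is not prime.\<close>

lemma min_dist_1_iff:
  assumes "\<not> prime_ideal I"
  shows "min_dist I d = 1 \<longleftrightarrow> (\<exists>f\<in>forms d. prime_ideal (colon I f))"
proof -
  let ?Z = "zero_divisor_forms I d"
  \<comment> \<open>A form with prime colon ideal is automatically a zero divisor: (I : f) = I would
    make I prime.\<close>
  have Z: "f \<in> ?Z" if "f \<in> forms d" "prime_ideal (colon I f)" for f
  proof -
    have "f \<notin> I" using that(2) colon_UNIV_iff[OF ideal, of f] by (auto simp: prime_ideal_def)
    moreover have "colon I f \<noteq> I" using that(2) assms by metis
    ultimately show ?thesis using that(1) by (simp add: zero_divisor_forms_def)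
  qed
  show ?thesis
  proof (cases "?Z = {}")
    case True
    \<comment> \<open>In this case \<open>min_dist\<close> is deg(S/I) = \<open>mult 1\<close>. It
      differs from 1 because 1 is a form of degree 0 whose colon ideal I is not prime.\<close>
    have "1 \<in> (forms 0 :: ('n, 'k) mpoly set)" by (simp add: forms_def)
    then have "mult 1 \<noteq> 1" using mult_1_iff[of 1 0] one_notin assms by (simp add: colon_1)
    then show ?thesis using True Z by (auto simp: min_dist_def degree_quot_I)
  next
    case False
    then obtain f0 where "f0 \<in> ?Z" by blast
    \<comment> \<open>\<open>GREATEST\<close> over the reals has a known value only once a maximum
      is exhibited. It is supplied by a least multiplicity, which exists among the naturals.\<close>
    then obtain f where f: "f \<in> ?Z" "\<And>g. g \<in> ?Z \<Longrightarrow> mult f \<le> mult g"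
      using ex_has_least_nat[of "\<lambda>f. f \<in> ?Z" f0 mult] by blast
    have "(GREATEST r. \<exists>f\<in>?Z. r = degree_quot (ideal_gen (insert f I))) = real (mult 1) - real (mult f)"
      using f degree_quot_insert by (intro Greatest_equality) auto
    then have dist: "min_dist I d = real (mult f)"
      using False by (simp add: min_dist_def degree_quot_I)
    show ?thesis
    proof
      assume "min_dist I d = 1"
      then have "mult f = 1" using dist by simp
      then show "\<exists>f\<in>forms d. prime_ideal (colon I f)"
        using f(1) mult_1_iff[of f d] by (auto simp: zero_divisor_forms_def)
    next
      assume "\<exists>f\<in>forms d. prime_ideal (colon I f)"
      then obtain g where g: "g \<in> forms d" "prime_ideal (colon I g)" by blast
      have "g \<in> ?Z" using Z g by blast
      moreover from this have "mult g = 1" using mult_1_iff[of g d] g by (auto simp: zero_divisor_forms_def)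
      ultimately have "mult f \<le> 1" using f(2)[of g] by simp
      moreover have "1 \<le> mult f" using f(1) mult_ge_1 by (auto simp: zero_divisor_forms_def)
      ultimately show "min_dist I d = 1" using dist by simp
    qed
  qed
qed

end

theorem proposition4p6:
  fixes I :: "('n::finite, 'k::field) mpoly set"
  assumes "graded_ideal I"
    and "I \<noteq> {0}"
    and "I \<subset> irrelevant_ideal"
    and "unmixed I"
    and "\<forall>P\<in>Ass I. generated_by_linear_forms P"
  shows "reg_min_dist I = v_number I"
proof -
  have ideal: "is_ideal I" and proper: "I \<noteq> UNIV"
    and height: "\<And>P Q. P \<in> Ass I \<Longrightarrow> Q \<in> Ass I \<Longrightarrow> height P = height Q"
    using assms(4) unfolding unmixed_def by blast+
  have Ass_colon: "colon I f \<in> Ass I \<longleftrightarrow> prime_ideal (colon I f)" for f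
    by (auto simp: Ass_def)
  show ?thesis
  proof (cases "prime_ideal I")
    case True
    \<comment> \<open>The left side is 1 by convention. The v-number is attained in degree 1: some
      variable lies outside I, and its colon ideal is the prime I itself.\<close>
    have "irrelevant_ideal \<subseteq> I" if "{tvar i | i. True} \<subseteq> I"
      unfolding irrelevant_ideal_def by (rule ideal_gen_minimal[OF ideal that])
    then obtain i where i: "tvar i \<notin> I" using assms(3) by blast
    have "colon I (tvar i) = I"
    proof (rule antisym[OF _ colon_superset[OF ideal]], rule subsetI)
      fix g assume "g \<in> colon I (tvar i)"
      then show "g \<in> I" using True i unfolding prime_ideal_def mem_colon by blast
    qed
    then have "\<exists>f\<in>forms 1. \<exists>P\<in>Ass I. colon I f = P"
      using True Ass_colon[of "tvar i"] by (intro bexI[of _ "tvar i"] tvar_in_forms) simp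
    then have "v_number I \<le> enat 1" unfolding v_number_def by (intro Inf_lower) auto
    moreover have "enat 1 \<le> v_number I" unfolding v_number_def by (intro Inf_greatest) auto
    ultimately show ?thesis using True by (simp add: reg_min_dist_def one_enat_def)
  next
    case False
    have "\<exists>P. P \<in> Ass I"
      using ex_Ass_colon[OF ideal, of "{1}" 1] proper ideal_UNIV_iff[OF ideal] by (auto simp: colon_1)
    then obtain P0 where P0: "P0 \<in> Ass I" by blast
    \<comment> \<open>Heights are the truncated differences s - \<open>linear_dim P\<close>; since
      \<open>linear_dim P\<close> is at most s, equal heights force equal dimensions.\<close>
    have "linear_dim P = linear_dim P0" if "P \<in> Ass I" for P
    proof -
      have lin: "generated_by_linear_forms P" "generated_by_linear_forms P0" using assms(5) that P0 by auto
      then show ?thesis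
        using height[OF that P0] linear_dim_le[OF lin(1)] linear_dim_le[OF lin(2)]
        by (simp add: height_linear)
    qed
    then interpret linear_unmixed I "linear_dim P0"
      using assms(1,5) proper by unfold_locales auto
    show ?thesis
      using False by (simp add: reg_min_dist_def v_number_def Ass_colon min_dist_1_iff)
  qed
qed

end
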